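(* Let $(\mathcal G,\mathcal H)$ be a matched pair of étale groupoids, let $\mathscr C=(C,q)$ be a Fell bundle over $\mathcal G\bowtie\mathcal H$ and suppose that there exists an $\mathcal H$-unitary family $u=(u_h)_{h\in\mathcal H}$ in $\mathscr C$. Let $\mathscr B=(B,p)=\iota^*(\mathscr C)$ be the pullback bundle along $\iota\colon\mathcal G\to\mathcal G\bowtie\mathcal H$, $\iota(x)=(x,s_{\mathcal G}(x))$, whose fibre $\mathscr B_x$ is identified with $\mathscr C_{(x,s(x))}$, and let $\beta$ be the $(\mathcal G,\mathcal H)$-compatible $\mathcal H$-action on $\mathscr B$ given by $\beta_h(a)=u_h\,a\,u_{h|_x}^*$ for $a\in\mathscr B_x$, $s_{\mathcal H}(h)=r_{\mathcal G}(x)$. Define $$\Theta\colon\{(a,h)\in B\times\mathcal H: s_{\mathcal G}(p(a))=r_{\mathcal H}(h)\}\to C,\qquad \Theta(a,h)=a\,u_h .$$ Then $\Theta$ is an isometric isomorphism $\mathscr B\bowtie_\beta\mathcal H\to\mathscr C$ of Fell bundles over $\mathcal G\bowtie\mathcal H$.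
   Context: All groupoids are locally compact Hausdorff étale; $r,s$ denote range and source. Matched pair. $\mathcal G,\mathcal H$ have the same unit space $\mathcal G^{(0)}=\mathcal H^{(0)}$, and there are continuous maps $(h,x)\mapsto h\cdot x\in\mathcal G$ and $(h,x)\mapsto h|_x\in\mathcal H$ defined on $\{(h,x)\in\mathcal H\times\mathcal G: s(h)=r(x)\}$ such that, whenever the expressions make sense: $(h_1h_2)\cdot x=h_1\cdot(h_2\cdot x)$; $r(h\cdot x)=r(h)$; $r(x)\cdot x=x$; $h|_{xy}=(h|_x)|_y$; $s(h|_x)=s(x)$; $h|_{s(h)}=h$; $s(h\cdot x)=r(h|_x)$; $h\cdot(xy)=(h\cdot x)(h|_x\cdot y)$; $(h_1h_2)|_x=h_1|_{h_2\cdot x}\,h_2|_x$. Zappa-Szép product. $\mathcal G\bowtie\mathcal H=\{(x,h)\in\mathcal G\times\mathcal H: s(x)=r(h)\}$ with the relative product topology, multiplication $(x,h)(y,g)=(x(h\cdot y),h|_y g)$ when $s(h)=r(y)$, inverse $(x,h)^{-1}=(h^{-1}\cdot x^{-1},h^{-1}|_{x^{-1}})$. It is an étale groupoid, whose unit space $\{(u,u)\}$ is identified with $\mathcal G^{(0)}=\mathcal H^{(0)}$. Fell bundle. An upper semi-continuous Banach bundle over a groupoid $\mathcal G$ is a topological space $B$ with a continuous open surjection $p\colon B\to\mathcal G$ whose fibres $\mathscr B_x=p^{-1}(x)$ are complex Banach spaces such that $b\mapsto\|b\|$ is upper semi-continuous; addition is continuous on $\{(a,b):p(a)=p(b)\}$;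 for each $\lambda\in\mathbb C$, $b\mapsto\lambda b$ is continuous; and if $p(b_i)\to x$ and $\|b_i\|\to0$ then $b_i\to 0\in\mathscr B_x$. It is a Fell bundle if it has a continuous multiplication $\mathscr B^{(2)}=\{(a,b):(p(a),p(b))\in\mathcal G^{(2)}\}\to B$ and a continuous involution $b\mapsto b^*$ on $B$ such that $p(ab)=p(a)p(b)$; multiplication is bilinear and associative; $\|ab\|\le\|a\|\|b\|$; $p(b^* )=p(b)^{-1}$; the involution is conjugate linear, $(ab)^*=b^*a^*$, $b^{**}=b$; $\|b^*b\|=\|b\|^2=\|b^*\|^2$; and $b^*b\ge0$ in the $C^*$-algebra $\mathscr B_{s(p(b))}$. Pullback. $\iota^*(\mathscr C)=\{(x,c)\in\mathcal G\times C:\iota(x)=q(c)\}$ with the subspace topology, $p(x,c)=x$, and operations $(x,c)(y,d)=(xy,cd)$, $(x,c)^*=(x^{-1},c^* )$; it is a Fell bundle over $\mathcal G$. $\mathcal H$-unitary family. Identify $h\in\mathcal H$ with $(r(h),h)\in\mathcal G\bowtie\mathcal H$. An $\mathcal H$-unitary family in $\mathscr C$ is a continuous map $h\mapsto u_h\in\mathscr C_{(r(h),h)}\subset C$ with $u_hu_k=u_{hk}$ for $(h,k)\in\mathcal H^{(2)}$, $u_h^*=u_{h^{-1}}$, and, for each $v\in\mathcal H^{(0)}$, $u_v=1_v$ the identity of $\mathscr C_v$. Compatible action. A $(\mathcal G,\mathcal H)$-compatible $\mathcal H$-action on $\mathscr B$ is a continuous map $\beta\colon\{(h,b)\in\mathcal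 H\times B: s(h)=r(p(b))\}\to B$, $\beta_h(b)=\beta(h,b)$, such that: $\beta_h$ maps $\mathscr B_x$ linearly into $\mathscr B_{h\cdot x}$; $\beta_{gh}=\beta_g\circ\beta_h$ for $(g,h)\in\mathcal H^{(2)}$; $\beta_u=\mathrm{id}$ for $u\in\mathcal H^{(0)}$; $\beta_h(bc)=\beta_h(b)\beta_{h|_{p(b)}}(c)$ for $(b,c)\in\mathscr B^{(2)}$; and $\beta_h(b)^*=\beta_{h|_x}(b^* )$ for $b\in\mathscr B_x$. Product bundle. $\mathscr B\bowtie_\beta\mathcal H$ is the Fell bundle over $\mathcal G\bowtie\mathcal H$ with total space $\{(b,h)\in B\times\mathcal H:s(p(b))=r(h)\}$ (subspace topology), bundle map $(b,h)\mapsto(p(b),h)$, fibre over $(x,h)$ with the Banach space structure of $\mathscr B_x$, multiplication $(a,g)\bullet(b,h)=(a\beta_g(b),g|_{p(b)}h)$ and involution $(b,h)^*=(\beta_{h^{-1}}(b^* ),h^{-1}|_{p(b)^{-1}})$. Isometric isomorphism of Fell bundles over the same groupoid: a continuous bijection between total spaces that preserves fibres, is linear on each fibre, multiplicative, $*$-preserving, and norm-preserving. *)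

theory Defs
  imports "HOL-Analysis.Analysis"
begin

record 'a groupoid =
  gtop :: "'a topology"
  rng :: "'a \<Rightarrow> 'a"
  src :: "'a \<Rightarrow> 'a"
  gmult :: "'a \<Rightarrow> 'a \<Rightarrow> 'a"
  ginv :: "'a \<Rightarrow> 'a"

definition arrows :: "('a, 'm) groupoid_scheme \<Rightarrow> 'a set" where
  "arrows G = topspace (gtop G)"

definition units :: "('a, 'm) groupoid_scheme \<Rightarrow> 'a set" where
  "units G = rng G ` arrows G"

definition composable :: "('a, 'm) groupoid_scheme \<Rightarrow> ('a \<times> 'a) set" where
  "composable G = {(x, y). x \<in> arrows G \<and> y \<in> arrows G \<and> src G x = rng G y}"

definition local_homeomorphism :: "'a topology \<Rightarrow> 'b topology \<Rightarrow> ('a \<Rightarrow> 'b) \<Rightarrow> bool" where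
  "local_homeomorphism X Y f \<longleftrightarrow>
     f \<in> topspace X \<rightarrow> topspace Y \<and>
     (\<forall>x \<in> topspace X. \<exists>U. openin X U \<and> x \<in> U \<and> openin Y (f ` U) \<and>
        homeomorphic_map (subtopology X U) (subtopology Y (f ` U)) f)"

locale etale_groupoid =
  fixes G :: "'a groupoid"
  assumes rng_closed: "x \<in> arrows G \<Longrightarrow> rng G x \<in> arrows G"
    and src_closed: "x \<in> arrows G \<Longrightarrow> src G x \<in> arrows G"
    and rng_rng: "x \<in> arrows G \<Longrightarrow> rng G (rng G x) = rng G x"
    and src_rng: "x \<in> arrows G \<Longrightarrow> src G (rng G x) = rng G x"
    and rng_src: "x \<in> arrows G \<Longrightarrow> rng G (src G x) = src G x"
    and src_src: "x \<in> arrows G \<Longrightarrow> src G (src G x) = src G x"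
    and mult_closed: "(x, y) \<in> composable G \<Longrightarrow> gmult G x y \<in> arrows G"
    and rng_mult: "(x, y) \<in> composable G \<Longrightarrow> rng G (gmult G x y) = rng G x"
    and src_mult: "(x, y) \<in> composable G \<Longrightarrow> src G (gmult G x y) = src G y"
    and mult_assoc: "\<lbrakk>(x, y) \<in> composable G; (y, z) \<in> composable G\<rbrakk> \<Longrightarrow>
      gmult G (gmult G x y) z = gmult G x (gmult G y z)"
    and rng_mult_left: "x \<in> arrows G \<Longrightarrow> gmult G (rng G x) x = x"
    and mult_src_right: "x \<in> arrows G \<Longrightarrow> gmult G x (src G x) = x"
    and inv_closed: "x \<in> arrows G \<Longrightarrow> ginv G x \<in> arrows G"
    and rng_inv: "x \<in> arrows G \<Longrightarrow> rng G (ginv G x) = src G x"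
    and src_inv: "x \<in> arrows G \<Longrightarrow> src G (ginv G x) = rng G x"
    and mult_inv_right: "x \<in> arrows G \<Longrightarrow> gmult G x (ginv G x) = rng G x"
    and mult_inv_left: "x \<in> arrows G \<Longrightarrow> gmult G (ginv G x) x = src G x"
    and continuous_mult: "continuous_map
      (subtopology (prod_topology (gtop G) (gtop G)) (composable G)) (gtop G)
      (\<lambda>(x, y). gmult G x y)"
    and continuous_inv: "continuous_map (gtop G) (gtop G) (ginv G)"
    and locally_compact: "locally_compact_space (gtop G)"
    and Hausdorff: "Hausdorff_space (gtop G)"
    and etale_rng: "local_homeomorphism (gtop G) (subtopology (gtop G) (units G)) (rng G)"
    and etale_src: "local_homeomorphism (gtop G) (subtopology (gtop G) (units G)) (src G)"

definition action_domain ::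
    "('a, 'm) groupoid_scheme \<Rightarrow> ('a, 'n) groupoid_scheme \<Rightarrow> ('a \<times> 'a) set" where
  "action_domain G H = {(h, x). h \<in> arrows H \<and> x \<in> arrows G \<and> src H h = rng G x}"

text \<open>
  Both groupoids live in one type, so that their unit spaces can literally coincide; no
  relation between non-unit arrows of \<open>G\<close> and \<open>H\<close> is implied.  Here \<open>act h x\<close> is
  \<open>h \<cdot> x\<close> and \<open>res h x\<close> is the restriction of \<open>h\<close> to \<open>x\<close>.
\<close>

locale matched_pair = G: etale_groupoid G + H: etale_groupoid H
  for G :: "'a groupoid" and H :: "'a groupoid" +
  fixes act :: "'a \<Rightarrow> 'a \<Rightarrow> 'a"
    and res :: "'a \<Rightarrow> 'a \<Rightarrow> 'a"
  assumes same_units: "units G = units H"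
    and same_unit_topology:
      "subtopology (gtop G) (units G) = subtopology (gtop H) (units H)"
    and continuous_act: "continuous_map
      (subtopology (prod_topology (gtop H) (gtop G)) (action_domain G H)) (gtop G)
      (\<lambda>(h, x). act h x)"
    and continuous_res: "continuous_map
      (subtopology (prod_topology (gtop H) (gtop G)) (action_domain G H)) (gtop H)
      (\<lambda>(h, x). res h x)"
    and mult_act: "\<lbrakk>(h, k) \<in> composable H; (k, x) \<in> action_domain G H\<rbrakk> \<Longrightarrow>
      act (gmult H h k) x = act h (act k x)"
    and rng_act: "(h, x) \<in> action_domain G H \<Longrightarrow> rng G (act h x) = rng H h"
    and unit_act: "x \<in> arrows G \<Longrightarrow> act (rng G x) x = x"
    and res_mult: "\<lbrakk>(h, x) \<in> action_domain G H; (x, y) \<in> composable G\<rbrakk> \<Longrightarrow>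
      res h (gmult G x y) = res (res h x) y"
    and src_res: "(h, x) \<in> action_domain G H \<Longrightarrow> src H (res h x) = src G x"
    and res_unit: "h \<in> arrows H \<Longrightarrow> res h (src H h) = h"
    and src_act: "(h, x) \<in> action_domain G H \<Longrightarrow> src G (act h x) = rng H (res h x)"
    and act_mult: "\<lbrakk>(h, x) \<in> action_domain G H; (x, y) \<in> composable G\<rbrakk> \<Longrightarrow>
      act h (gmult G x y) = gmult G (act h x) (act (res h x) y)"
    and mult_res: "\<lbrakk>(h, k) \<in> composable H; (k, x) \<in> action_domain G H\<rbrakk> \<Longrightarrow>
      res (gmult H h k) x = gmult H (res h (act k x)) (res k x)"

definition zappa_szep ::
    "'a groupoid \<Rightarrow> 'a groupoid \<Rightarrow> ('a \<Rightarrow> 'a \<Rightarrow> 'a) \<Rightarrow> ('a \<Rightarrow> 'a \<Rightarrow> 'a) \<Rightarrow> ('a \<times> 'a) groupoid"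
where
  "zappa_szep G H act res =
     \<lparr> gtop = subtopology (prod_topology (gtop G) (gtop H)) {(x, h). src G x = rng H h},
       rng = (\<lambda>(x, h). (rng G x, rng G x)),
       src = (\<lambda>(x, h). (src H h, src H h)),
       gmult = (\<lambda>(x, h) (y, g). (gmult G x (act h y), gmult H (res h y) g)),
       ginv = (\<lambda>(x, h). (act (ginv H h) (ginv G x), res (ginv H h) (ginv G x))) \<rparr>"

locale complex_banach_space =
  fixes V :: "'b set"
    and add :: "'b \<Rightarrow> 'b \<Rightarrow> 'b"
    and scale :: "complex \<Rightarrow> 'b \<Rightarrow> 'b"
    and zero :: 'b
    and nrm :: "'b \<Rightarrow> real"
  assumes zero_closed: "zero \<in> V"
    and add_closed: "\<lbrakk>a \<in> V; b \<in> V\<rbrakk> \<Longrightarrow> add a b \<in> V"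
    and scale_closed: "a \<in> V \<Longrightarrow> scale z a \<in> V"
    and add_assoc: "\<lbrakk>a \<in> V; b \<in> V; c \<in> V\<rbrakk> \<Longrightarrow> add (add a b) c = add a (add b c)"
    and add_commute: "\<lbrakk>a \<in> V; b \<in> V\<rbrakk> \<Longrightarrow> add a b = add b a"
    and add_zero: "a \<in> V \<Longrightarrow> add a zero = a"
    and add_minus: "a \<in> V \<Longrightarrow> add a (scale (-1) a) = zero"
    and scale_add: "\<lbrakk>a \<in> V; b \<in> V\<rbrakk> \<Longrightarrow> scale z (add a b) = add (scale z a) (scale z b)"
    and add_scale: "a \<in> V \<Longrightarrow> scale (z + w) a = add (scale z a) (scale w a)"
    and scale_scale: "a \<in> V \<Longrightarrow> scale z (scale w a) = scale (z * w) a"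
    and one_scale: "a \<in> V \<Longrightarrow> scale 1 a = a"
    and norm_nonneg: "a \<in> V \<Longrightarrow> 0 \<le> nrm a"
    and norm_eq_zero: "a \<in> V \<Longrightarrow> nrm a = 0 \<longleftrightarrow> a = zero"
    and norm_triangle: "\<lbrakk>a \<in> V; b \<in> V\<rbrakk> \<Longrightarrow> nrm (add a b) \<le> nrm a + nrm b"
    and norm_scale: "a \<in> V \<Longrightarrow> nrm (scale z a) = cmod z * nrm a"
    and complete: "\<lbrakk>\<And>n::nat. f n \<in> V;
        \<And>e. 0 < e \<Longrightarrow> \<exists>N. \<forall>m\<ge>N. \<forall>n\<ge>N. nrm (add (f m) (scale (-1) (f n))) < e\<rbrakk> \<Longrightarrow>
      \<exists>l\<in>V. (\<lambda>n. nrm (add (f n) (scale (-1) l))) \<longlonglongrightarrow> 0"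

record ('x, 'b) bundle_data =
  btop :: "'b topology"
  proj :: "'b \<Rightarrow> 'x"
  badd :: "'b \<Rightarrow> 'b \<Rightarrow> 'b"
  bscale :: "complex \<Rightarrow> 'b \<Rightarrow> 'b"
  bzero :: "'x \<Rightarrow> 'b"
  bnorm :: "'b \<Rightarrow> real"
  bmult :: "'b \<Rightarrow> 'b \<Rightarrow> 'b"
  bstar :: "'b \<Rightarrow> 'b"

definition total_space :: "('x, 'b, 'm) bundle_data_scheme \<Rightarrow> 'b set" where
  "total_space B = topspace (btop B)"

definition fibre :: "('x, 'b, 'm) bundle_data_scheme \<Rightarrow> 'x \<Rightarrow> 'b set" where
  "fibre B x = {b \<in> total_space B. proj B b = x}"

definition bcomposable ::
    "('x, 'm) groupoid_scheme \<Rightarrow> ('x, 'b, 'n) bundle_data_scheme \<Rightarrow> ('b \<times> 'b) set" where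
  "bcomposable G B =
     {(a, b). a \<in> total_space B \<and> b \<in> total_space B \<and> (proj B a, proj B b) \<in> composable G}"

text \<open>
  In \<open>small_norm\<close> the nets of the usual definition are replaced by filters on the total space:
  a net in the total space converges exactly if the filter it generates does.
\<close>

locale usc_banach_bundle =
  fixes G :: "'x groupoid"
    and B :: "('x, 'b) bundle_data"
  assumes continuous_proj: "continuous_map (btop B) (gtop G) (proj B)"
    and open_proj: "open_map (btop B) (gtop G) (proj B)"
    and surj_proj: "proj B ` total_space B = arrows G"
    and banach_fibre: "x \<in> arrows G \<Longrightarrow>
      complex_banach_space (fibre B x) (badd B) (bscale B) (bzero B x) (bnorm B)"
    and usc_norm: "openin (btop B) {b \<in> total_space B. bnorm B b < t}"
    and continuous_add: "continuous_map
      (subtopology (prod_topology (btop B) (btop B)) {(a, b). proj B a = proj B b}) (btop B)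
      (\<lambda>(a, b). badd B a b)"
    and continuous_scale: "continuous_map (btop B) (btop B) (bscale B z)"
    and small_norm: "\<lbrakk>x \<in> arrows G; eventually (\<lambda>b. b \<in> total_space B) F;
        limitin (gtop G) (proj B) x F; (bnorm B \<longlongrightarrow> 0) F\<rbrakk> \<Longrightarrow>
      limitin (btop B) (\<lambda>b. b) (bzero B x) F"

text \<open>
  The unit fibres need not have an identity, so the spectrum of an element \<open>a\<close> of the
  fibre over the unit \<open>v\<close> is taken in the unitization \<open>fibre B v \<oplus> \<complex>\<close>, whose
  identity is \<open>(0, 1)\<close>: it consists of the \<open>z\<close> for which \<open>a - z 1 = (a, -z)\<close> is not
  invertible.  An element of the fibre is positive if it is self-adjoint with spectrum in
  the nonnegative reals.
\<close>

definition unitization_mult ::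
    "('x, 'b, 'm) bundle_data_scheme \<Rightarrow> 'b \<times> complex \<Rightarrow> 'b \<times> complex \<Rightarrow> 'b \<times> complex" where
  "unitization_mult B = (\<lambda>(a, z) (b, w).
     (badd B (bmult B a b) (badd B (bscale B z b) (bscale B w a)), z * w))"

definition fibre_spectrum :: "('x, 'b, 'm) bundle_data_scheme \<Rightarrow> 'x \<Rightarrow> 'b \<Rightarrow> complex set" where
  "fibre_spectrum B v a =
     {z. \<not> (\<exists>c \<in> fibre B v \<times> UNIV.
            unitization_mult B (a, - z) c = (bzero B v, 1) \<and>
            unitization_mult B c (a, - z) = (bzero B v, 1))}"

definition fibre_positive :: "('x, 'b, 'm) bundle_data_scheme \<Rightarrow> 'x \<Rightarrow> 'b \<Rightarrow> bool" where
  "fibre_positive B v a \<longleftrightarrow>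
     a \<in> fibre B v \<and> bstar B a = a \<and> fibre_spectrum B v a \<subseteq> \<real>\<^sub>\<ge>\<^sub>0"

locale fell_bundle = usc_banach_bundle G B
  for G :: "'x groupoid" and B :: "('x, 'b) bundle_data" +
  assumes continuous_bmult: "continuous_map
      (subtopology (prod_topology (btop B) (btop B)) (bcomposable G B)) (btop B)
      (\<lambda>(a, b). bmult B a b)"
    and continuous_bstar: "continuous_map (btop B) (btop B) (bstar B)"
    and proj_mult: "(a, b) \<in> bcomposable G B \<Longrightarrow>
      proj B (bmult B a b) = gmult G (proj B a) (proj B b)"
    and mult_add_left: "\<lbrakk>(a, b) \<in> bcomposable G B; (a', b) \<in> bcomposable G B;
        proj B a = proj B a'\<rbrakk> \<Longrightarrow>
      bmult B (badd B a a') b = badd B (bmult B a b) (bmult B a' b)"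
    and mult_add_right: "\<lbrakk>(a, b) \<in> bcomposable G B; (a, b') \<in> bcomposable G B;
        proj B b = proj B b'\<rbrakk> \<Longrightarrow>
      bmult B a (badd B b b') = badd B (bmult B a b) (bmult B a b')"
    and mult_scale_left: "(a, b) \<in> bcomposable G B \<Longrightarrow>
      bmult B (bscale B z a) b = bscale B z (bmult B a b)"
    and mult_scale_right: "(a, b) \<in> bcomposable G B \<Longrightarrow>
      bmult B a (bscale B z b) = bscale B z (bmult B a b)"
    and bmult_assoc: "\<lbrakk>(a, b) \<in> bcomposable G B; (b, c) \<in> bcomposable G B\<rbrakk> \<Longrightarrow>
      bmult B (bmult B a b) c = bmult B a (bmult B b c)"
    and norm_mult: "(a, b) \<in> bcomposable G B \<Longrightarrow>
      bnorm B (bmult B a b) \<le> bnorm B a * bnorm B b"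
    and proj_star: "b \<in> total_space B \<Longrightarrow> proj B (bstar B b) = ginv G (proj B b)"
    and star_add: "\<lbrakk>a \<in> total_space B; b \<in> total_space B; proj B a = proj B b\<rbrakk> \<Longrightarrow>
      bstar B (badd B a b) = badd B (bstar B a) (bstar B b)"
    and star_scale: "b \<in> total_space B \<Longrightarrow> bstar B (bscale B z b) = bscale B (cnj z) (bstar B b)"
    and star_mult: "(a, b) \<in> bcomposable G B \<Longrightarrow>
      bstar B (bmult B a b) = bmult B (bstar B b) (bstar B a)"
    and star_star: "b \<in> total_space B \<Longrightarrow> bstar B (bstar B b) = b"
    and norm_star_mult: "b \<in> total_space B \<Longrightarrow> bnorm B (bmult B (bstar B b) b) = (bnorm B b)\<^sup>2"
    and norm_star: "b \<in> total_space B \<Longrightarrow> (bnorm B (bstar B b))\<^sup>2 = (bnorm B b)\<^sup>2"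
    and star_mult_positive: "b \<in> total_space B \<Longrightarrow>
      fibre_positive B (src G (proj B b)) (bmult B (bstar B b) b)"

locale fell_bundle_isometric_isomorphism =
  B: fell_bundle G B + C: fell_bundle G C
  for G :: "'x groupoid" and B :: "('x, 'b) bundle_data" and C :: "('x, 'c) bundle_data" +
  fixes T :: "'b \<Rightarrow> 'c"
  assumes iso_continuous: "continuous_map (btop B) (btop C) T"
    and iso_bij: "bij_betw T (total_space B) (total_space C)"
    and iso_proj: "b \<in> total_space B \<Longrightarrow> proj C (T b) = proj B b"
    and iso_add: "\<lbrakk>a \<in> total_space B; b \<in> total_space B; proj B a = proj B b\<rbrakk> \<Longrightarrow>
      T (badd B a b) = badd C (T a) (T b)"
    and iso_scale: "b \<in> total_space B \<Longrightarrow> T (bscale B z b) = bscale C z (T b)"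
    and iso_mult: "(a, b) \<in> bcomposable G B \<Longrightarrow> T (bmult B a b) = bmult C (T a) (T b)"
    and iso_star: "b \<in> total_space B \<Longrightarrow> T (bstar B b) = bstar C (T b)"
    and iso_norm: "b \<in> total_space B \<Longrightarrow> bnorm C (T b) = bnorm B b"

definition pullback ::
    "'a groupoid \<Rightarrow> ('a \<Rightarrow> 'x) \<Rightarrow> ('x, 'c) bundle_data \<Rightarrow> ('a, 'a \<times> 'c) bundle_data" where
  "pullback G f C =
     \<lparr> btop = subtopology (prod_topology (gtop G) (btop C)) {(x, c). f x = proj C c},
       proj = fst,
       badd = (\<lambda>(x, c) (y, d). (x, badd C c d)),
       bscale = (\<lambda>z (x, c). (x, bscale C z c)),
       bzero = (\<lambda>x. (x, bzero C (f x))),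
       bnorm = (\<lambda>(x, c). bnorm C c),
       bmult = (\<lambda>(x, c) (y, d). (gmult G x y, bmult C c d)),
       bstar = (\<lambda>(x, c). (ginv G x, bstar C c)) \<rparr>"

definition bundle_action_domain ::
    "'a groupoid \<Rightarrow> 'a groupoid \<Rightarrow> ('a, 'b) bundle_data \<Rightarrow> ('a \<times> 'b) set" where
  "bundle_action_domain G H B =
     {(h, b). h \<in> arrows H \<and> b \<in> total_space B \<and> src H h = rng G (proj B b)}"

locale compatible_action = matched_pair G H act res + B: fell_bundle G B
  for G :: "'a groupoid" and H :: "'a groupoid"
    and act :: "'a \<Rightarrow> 'a \<Rightarrow> 'a" and res :: "'a \<Rightarrow> 'a \<Rightarrow> 'a"
    and B :: "('a, 'b) bundle_data" +
  fixes \<beta> :: "'a \<Rightarrow> 'b \<Rightarrow> 'b"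
  assumes continuous_beta: "continuous_map
      (subtopology (prod_topology (gtop H) (btop B)) (bundle_action_domain G H B)) (btop B)
      (\<lambda>(h, b). \<beta> h b)"
    and proj_beta: "(h, b) \<in> bundle_action_domain G H B \<Longrightarrow>
      proj B (\<beta> h b) = act h (proj B b)"
    and beta_add: "\<lbrakk>(h, a) \<in> bundle_action_domain G H B; (h, b) \<in> bundle_action_domain G H B;
        proj B a = proj B b\<rbrakk> \<Longrightarrow> \<beta> h (badd B a b) = badd B (\<beta> h a) (\<beta> h b)"
    and beta_scale: "(h, b) \<in> bundle_action_domain G H B \<Longrightarrow>
      \<beta> h (bscale B z b) = bscale B z (\<beta> h b)"
    and beta_comp: "\<lbrakk>(g, h) \<in> composable H; (h, b) \<in> bundle_action_domain G H B\<rbrakk> \<Longrightarrow>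
      \<beta> (gmult H g h) b = \<beta> g (\<beta> h b)"
    and beta_unit: "\<lbrakk>v \<in> units H; (v, b) \<in> bundle_action_domain G H B\<rbrakk> \<Longrightarrow> \<beta> v b = b"
    and beta_mult: "\<lbrakk>(h, b) \<in> bundle_action_domain G H B; (b, c) \<in> bcomposable G B\<rbrakk> \<Longrightarrow>
      \<beta> h (bmult B b c) = bmult B (\<beta> h b) (\<beta> (res h (proj B b)) c)"
    and beta_star: "(h, b) \<in> bundle_action_domain G H B \<Longrightarrow>
      bstar B (\<beta> h b) = \<beta> (res h (proj B b)) (bstar B b)"

definition product_bundle ::
    "'a groupoid \<Rightarrow> 'a groupoid \<Rightarrow> ('a \<Rightarrow> 'a \<Rightarrow> 'a) \<Rightarrow> ('a, 'b) bundle_data \<Rightarrow>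
     ('a \<Rightarrow> 'b \<Rightarrow> 'b) \<Rightarrow> ('a \<times> 'a, 'b \<times> 'a) bundle_data" where
  "product_bundle G H res B \<beta> =
     \<lparr> btop = subtopology (prod_topology (btop B) (gtop H))
                {(b, h). src G (proj B b) = rng H h},
       proj = (\<lambda>(b, h). (proj B b, h)),
       badd = (\<lambda>(a, g) (b, h). (badd B a b, g)),
       bscale = (\<lambda>z (b, h). (bscale B z b, h)),
       bzero = (\<lambda>(x, h). (bzero B x, h)),
       bnorm = (\<lambda>(b, h). bnorm B b),
       bmult = (\<lambda>(a, g) (b, h). (bmult B a (\<beta> g b), gmult H (res g (proj B b)) h)),
       bstar = (\<lambda>(b, h). (\<beta> (ginv H h) (bstar B b), res (ginv H h) (ginv G (proj B b)))) \<rparr>"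

text \<open>An arrow \<open>h\<close> of \<open>H\<close> is identified with \<open>(r(h), h)\<close>, a unit \<open>v\<close> with \<open>(v, v)\<close>.\<close>

locale unitary_family =
  fixes H :: "'a groupoid"
    and C :: "('a \<times> 'a, 'c) bundle_data"
    and u :: "'a \<Rightarrow> 'c"
  assumes continuous_u: "continuous_map (gtop H) (btop C) u"
    and u_fibre: "h \<in> arrows H \<Longrightarrow> u h \<in> fibre C (rng H h, h)"
    and u_mult: "(h, k) \<in> composable H \<Longrightarrow> bmult C (u h) (u k) = u (gmult H h k)"
    and u_star: "h \<in> arrows H \<Longrightarrow> bstar C (u h) = u (ginv H h)"
    and u_unit_left: "\<lbrakk>v \<in> units H; c \<in> fibre C (v, v)\<rbrakk> \<Longrightarrow> bmult C (u v) c = c"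
    and u_unit_right: "\<lbrakk>v \<in> units H; c \<in> fibre C (v, v)\<rbrakk> \<Longrightarrow> bmult C c (u v) = c"

definition iota :: "'a groupoid \<Rightarrow> 'a \<Rightarrow> 'a \<times> 'a" where
  "iota G x = (x, src G x)"

text \<open>
  Elements of the pullback of \<open>C\<close> along \<open>iota G\<close> are pairs \<open>(x, c)\<close> with \<open>c\<close> in
  the fibre of \<open>C\<close> over \<open>(x, s(x))\<close>; the following two maps act on the component \<open>c\<close>.
\<close>

definition unitary_action ::
    "('a \<Rightarrow> 'a \<Rightarrow> 'a) \<Rightarrow> ('a \<Rightarrow> 'a \<Rightarrow> 'a) \<Rightarrow> ('a \<times> 'a, 'c) bundle_data \<Rightarrow> ('a \<Rightarrow> 'c) \<Rightarrow>
     'a \<Rightarrow> 'a \<times> 'c \<Rightarrow> 'a \<times> 'c" where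
  "unitary_action act res C u h =
     (\<lambda>(x, c). (act h x, bmult C (bmult C (u h) c) (bstar C (u (res h x)))))"

definition Theta ::
    "('a \<times> 'a, 'c) bundle_data \<Rightarrow> ('a \<Rightarrow> 'c) \<Rightarrow> ('a \<times> 'c) \<times> 'a \<Rightarrow> 'c" where
  "Theta C u = (\<lambda>((x, c), h). bmult C c (u h))"

end

theory Submission
  imports Defs
begin

text \<open>
  Write \<open>K\<close> for the Zappa-Szep product and \<open>(x, h) = (x, s(x)) (r(h), h)\<close>.  An element \<open>c\<close>
  over \<open>(x, h)\<close> can be divided by the unitary \<open>u\<^sub>h\<close>: the element \<open>c u\<^sub>h\<^sup>*\<close> lies over
  \<open>(x, s(x))\<close>, and \<open>c = (c u\<^sub>h\<^sup>*) u\<^sub>h\<close>.  Hence \<open>\<Theta>(a, h) = a u\<^sub>h\<close> has the continuous inverse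
  \<open>c \<mapsto> (c u\<^sub>h\<^sup>*, h)\<close> and is a homeomorphism.  The operations of the product bundle are made so that
  \<open>\<Theta>\<close> preserves them; for instance
  \<open>a (u\<^sub>g b u\<^sup>*) u u\<^sub>h = (a u\<^sub>g) (b u\<^sub>h)\<close>, where \<open>u\<close> is the unitary at the restriction of \<open>g\<close>
  to the base point of \<open>b\<close>.  Right multiplication by \<open>u\<^sub>h\<close> and by \<open>u\<^sub>h\<^sup>*\<close> are both contractive, so
  \<open>\<Theta>\<close> is isometric.

  All these computations cancel terms \<open>u\<^sub>v\<close> with \<open>v\<close> a unit.  A unitary family only requires
  \<open>u\<^sub>v\<close> to be an identity of the fibre over \<open>v\<close>; that it is also an identity on every fibre whose
  source is \<open>v\<close> follows from the \<open>C\<^sup>*\<close>-condition (lemma \<open>mult_u_unit\<close>).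

  The statement also contains that the pullback and the product are Fell bundles.  For the pullback,
  this is checked for an arbitrary continuous homomorphism in \<open>fell_bundle_pullback\<close>; the
  inclusion of the first factor is one because in a matched pair \<open>r(y)\<close> restricted to \<open>y\<close> is \<open>s(y)\<close>
  and \<open>h \<cdot> s(h) = r(h)\<close>, both being idempotents.  For the product, no axiom is checked by hand: its
  operations stay inside the total space and are carried by the homeomorphism \<open>\<Theta>\<close> to those of the
  given bundle, so every axiom is inherited along \<open>\<Theta>\<close> (locale \<open>fell_bundle_transport\<close>).
\<close>

section \<open>Groupoids without topology\<close>

text \<open>
  These are the laws of the base groupoid behind associativity and positivity in a Fell bundle.  The
  Zappa-Szep product satisfies them by computation with the rules of a matched pair.  Composability
  is written out as an equation between source and range so that the simplifier can discharge it.
\<close>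

locale abstract_groupoid =
  fixes G :: "'a groupoid"
  assumes rng_arrow [simp]: "x \<in> arrows G \<Longrightarrow> rng G x \<in> arrows G"
    and src_arrow [simp]: "x \<in> arrows G \<Longrightarrow> src G x \<in> arrows G"
    and rng_rng [simp]: "x \<in> arrows G \<Longrightarrow> rng G (rng G x) = rng G x"
    and src_rng [simp]: "x \<in> arrows G \<Longrightarrow> src G (rng G x) = rng G x"
    and rng_src [simp]: "x \<in> arrows G \<Longrightarrow> rng G (src G x) = src G x"
    and src_src [simp]: "x \<in> arrows G \<Longrightarrow> src G (src G x) = src G x"
    and mult_arrow [simp]: "\<lbrakk>x \<in> arrows G; y \<in> arrows G; src G x = rng G y\<rbrakk> \<Longrightarrow>
      gmult G x y \<in> arrows G"
    and rng_mult [simp]: "\<lbrakk>x \<in> arrows G; y \<in> arrows G; src G x = rng G y\<rbrakk> \<Longrightarrow>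
      rng G (gmult G x y) = rng G x"
    and src_mult [simp]: "\<lbrakk>x \<in> arrows G; y \<in> arrows G; src G x = rng G y\<rbrakk> \<Longrightarrow>
      src G (gmult G x y) = src G y"
    and assoc: "\<lbrakk>x \<in> arrows G; y \<in> arrows G; z \<in> arrows G;
        src G x = rng G y; src G y = rng G z\<rbrakk> \<Longrightarrow>
      gmult G (gmult G x y) z = gmult G x (gmult G y z)"
    and rng_mult_left [simp]: "x \<in> arrows G \<Longrightarrow> gmult G (rng G x) x = x"
    and mult_src_right [simp]: "x \<in> arrows G \<Longrightarrow> gmult G x (src G x) = x"
    and inv_arrow [simp]: "x \<in> arrows G \<Longrightarrow> ginv G x \<in> arrows G"
    and rng_inv [simp]: "x \<in> arrows G \<Longrightarrow> rng G (ginv G x) = src G x"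
    and src_inv [simp]: "x \<in> arrows G \<Longrightarrow> src G (ginv G x) = rng G x"
    and mult_inv_right [simp]: "x \<in> arrows G \<Longrightarrow> gmult G x (ginv G x) = rng G x"
    and mult_inv_left [simp]: "x \<in> arrows G \<Longrightarrow> gmult G (ginv G x) x = src G x"
begin

lemma idempotent_imp_unit:
  assumes "x \<in> arrows G" "src G x = rng G x" "gmult G x x = x"
  shows "x = src G x"
proof -
  have "x = gmult G (gmult G (ginv G x) x) x"
    using assms by simp
  also have "\<dots> = gmult G (ginv G x) (gmult G x x)"
    by (rule assoc) (use assms in simp_all)
  finally show ?thesis
    using assms by simp
qed

lemma inverse_unique:
  assumes "x \<in> arrows G" "y \<in> arrows G" "src G x = rng G y" "gmult G x y = rng G x"
  shows "y = ginv G x"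
proof -
  have "y = gmult G (gmult G (ginv G x) x) y"
    using assms by simp
  also have "\<dots> = gmult G (ginv G x) (gmult G x y)"
    by (rule assoc) (use assms in simp_all)
  also have "\<dots> = gmult G (ginv G x) (src G (ginv G x))"
    using assms by simp
  finally show ?thesis
    using assms by (simp del: src_inv)
qed

lemma inv_inv [simp]: "x \<in> arrows G \<Longrightarrow> ginv G (ginv G x) = x"
  by (rule inverse_unique[symmetric]) simp_all

lemma inv_mult:
  assumes "x \<in> arrows G" "y \<in> arrows G" "src G x = rng G y"
  shows "ginv G (gmult G x y) = gmult G (ginv G y) (ginv G x)"
proof (rule inverse_unique[symmetric])
  have "gmult G (gmult G x y) (gmult G (ginv G y) (ginv G x)) =
      gmult G x (gmult G (gmult G y (ginv G y)) (ginv G x))"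
    using assms by (simp add: assoc del: mult_inv_right)
  also have "gmult G (gmult G y (ginv G y)) (ginv G x) = ginv G x"
    using assms rng_mult_left[of "ginv G x"] by simp
  finally show "gmult G (gmult G x y) (gmult G (ginv G y) (ginv G x)) = rng G (gmult G x y)"
    using assms by simp
qed (use assms in simp_all)

lemma inv_unit: "x \<in> arrows G \<Longrightarrow> rng G x = x \<Longrightarrow> ginv G x = x"
  using inverse_unique[of x x] by (metis rng_mult_left src_rng)

lemma unitD:
  assumes "v \<in> units G"
  shows "v \<in> arrows G" "rng G v = v" "src G v = v" "ginv G v = v" "gmult G v v = v"
proof -
  show *: "v \<in> arrows G" "rng G v = v" "src G v = v"
    using assms by (auto simp: units_def)
  show "ginv G v = v" "gmult G v v = v"
    using * inv_unit rng_mult_left by fastforce+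
qed

lemma rng_unit [simp]: "x \<in> arrows G \<Longrightarrow> rng G x \<in> units G"
  by (simp add: units_def)

lemma src_unit [simp]: "x \<in> arrows G \<Longrightarrow> src G x \<in> units G"
  by (metis rng_src rng_unit src_arrow)

end

sublocale etale_groupoid \<subseteq> abstract_groupoid
  by unfold_locales (simp_all add: composable_def rng_closed src_closed rng_rng src_rng rng_src src_src mult_closed
    rng_mult src_mult mult_assoc rng_mult_left mult_src_right inv_closed rng_inv src_inv
    mult_inv_right mult_inv_left)

section \<open>Isomorphic fibres\<close>

text \<open>
  The two base points may belong to different groupoids: for a pullback, a fibre over \<open>v\<close> is compared
  with the fibre of the original bundle over the image of \<open>v\<close>.
\<close>

locale fibre_iso =
  fixes B :: "('x, 'b) bundle_data" and v :: 'x
    and C :: "('y, 'c) bundle_data" and w :: 'y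
    and T :: "'b \<Rightarrow> 'c"
  assumes T_image: "T ` fibre B v = fibre C w"
    and T_inj: "inj_on T (fibre B v)"
    and zero_fibre: "bzero B v \<in> fibre B v"
    and add_fibre: "\<lbrakk>a \<in> fibre B v; b \<in> fibre B v\<rbrakk> \<Longrightarrow> badd B a b \<in> fibre B v"
    and scale_fibre: "a \<in> fibre B v \<Longrightarrow> bscale B z a \<in> fibre B v"
    and T_zero: "T (bzero B v) = bzero C w"
    and T_add: "\<lbrakk>a \<in> fibre B v; b \<in> fibre B v\<rbrakk> \<Longrightarrow> T (badd B a b) = badd C (T a) (T b)"
    and T_scale: "a \<in> fibre B v \<Longrightarrow> T (bscale B z a) = bscale C z (T a)"
    and T_norm: "a \<in> fibre B v \<Longrightarrow> bnorm C (T a) = bnorm B a"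
begin

lemma T_fibre: "a \<in> fibre B v \<Longrightarrow> T a \<in> fibre C w"
  using T_image by blast

lemma T_eq_iff: "\<lbrakk>a \<in> fibre B v; b \<in> fibre B v\<rbrakk> \<Longrightarrow> T a = T b \<longleftrightarrow> a = b"
  using T_inj by (auto dest: inj_onD)

lemmas closed = zero_fibre add_fibre scale_fibre
lemmas hom = T_zero T_add T_scale T_norm T_fibre

lemma complex_banach_space_transfer:
  assumes "complex_banach_space (fibre C w) (badd C) (bscale C) (bzero C w) (bnorm C)"
  shows "complex_banach_space (fibre B v) (badd B) (bscale B) (bzero B v) (bnorm B)"
proof -
  interpret W: complex_banach_space "fibre C w" "badd C" "bscale C" "bzero C w" "bnorm C"
    by fact
  have eqI: "a = b" if "T a = T b" "a \<in> fibre B v" "b \<in> fibre B v" for a b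
    using that T_eq_iff by blast
  show ?thesis
  proof
    fix f :: "nat \<Rightarrow> 'b"
    assume f: "\<And>n. f n \<in> fibre B v"
      and cauchy: "\<And>e. 0 < e \<Longrightarrow>
        \<exists>N. \<forall>m\<ge>N. \<forall>n\<ge>N. bnorm B (badd B (f m) (bscale B (-1) (f n))) < e"
    have dist: "bnorm C (badd C (T a) (bscale C (-1) (T b))) = bnorm B (badd B a (bscale B (-1) b))"
      if "a \<in> fibre B v" "b \<in> fibre B v" for a b
      using that by (simp flip: T_scale T_add add: T_norm closed)
    have "\<exists>l\<in>fibre C w. (\<lambda>n. bnorm C (badd C (T (f n)) (bscale C (-1) l))) \<longlonglongrightarrow> 0"
      by (rule W.complete) (use f cauchy in \<open>simp_all add: dist T_fibre\<close>)
    then obtain l where "l \<in> fibre B v"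
        "(\<lambda>n. bnorm C (badd C (T (f n)) (bscale C (-1) (T l)))) \<longlonglongrightarrow> 0"
      using T_image by force
    then show "\<exists>l\<in>fibre B v. (\<lambda>n. bnorm B (badd B (f n) (bscale B (-1) l))) \<longlonglongrightarrow> 0"
      using f by (auto simp: dist)
  next
    fix a b c :: 'b and z w
    assume a: "a \<in> fibre B v"
    show "bscale B 1 a = a"
      by (rule eqI) (use a in \<open>simp_all add: closed hom W.one_scale\<close>)
    show "badd B a (bzero B v) = a"
      by (rule eqI) (use a in \<open>simp_all add: closed hom W.add_zero\<close>)
    show "badd B a (bscale B (-1) a) = bzero B v"
      by (rule eqI) (use a in \<open>simp_all add: closed hom W.add_minus\<close>)
    show "bscale B (z + w) a = badd B (bscale B z a) (bscale B w a)"
      by (rule eqI) (use a in \<open>simp_all add: closed hom W.add_scale\<close>)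
    show "bscale B z (bscale B w a) = bscale B (z * w) a"
      by (rule eqI) (use a in \<open>simp_all add: closed hom W.scale_scale\<close>)
    show "0 \<le> bnorm B a"
      using a W.norm_nonneg[OF T_fibre[OF a]] by (simp add: hom)
    show "bnorm B a = 0 \<longleftrightarrow> a = bzero B v"
      using a W.norm_eq_zero[OF T_fibre[OF a]] T_eq_iff[OF a zero_fibre] by (simp add: hom)
    show "bnorm B (bscale B z a) = cmod z * bnorm B a"
      using a W.norm_scale[OF T_fibre[OF a]] by (simp flip: T_scale add: T_norm closed)
    assume b: "b \<in> fibre B v"
    show "badd B a b = badd B b a"
      by (rule eqI) (use a b W.add_commute in \<open>simp_all add: closed hom\<close>)
    show "bscale B z (badd B a b) = badd B (bscale B z a) (bscale B z b)"
      by (rule eqI) (use a b in \<open>simp_all add: closed hom W.scale_add\<close>)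
    show "bnorm B (badd B a b) \<le> bnorm B a + bnorm B b"
      using a b W.norm_triangle[OF T_fibre[OF a] T_fibre[OF b]]
      by (simp flip: T_add add: T_norm closed)
    assume c: "c \<in> fibre B v"
    show "badd B (badd B a b) c = badd B a (badd B b c)"
      by (rule eqI) (use a b c in \<open>simp_all add: closed hom W.add_assoc\<close>)
  qed (simp_all add: closed)
qed

end

locale fibre_algebra_iso = fibre_iso +
  assumes mult_fibre: "\<lbrakk>a \<in> fibre B v; b \<in> fibre B v\<rbrakk> \<Longrightarrow> bmult B a b \<in> fibre B v"
    and star_fibre: "a \<in> fibre B v \<Longrightarrow> bstar B a \<in> fibre B v"
    and T_mult: "\<lbrakk>a \<in> fibre B v; b \<in> fibre B v\<rbrakk> \<Longrightarrow> T (bmult B a b) = bmult C (T a) (T b)"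
    and T_star: "a \<in> fibre B v \<Longrightarrow> T (bstar B a) = bstar C (T a)"
begin

text \<open>
  If \<open>a - z 1\<close> is invertible after applying \<open>T\<close>, the inverse has a preimage under \<open>T\<close>, and
  injectivity turns the two equations for the inverse into the same equations before applying \<open>T\<close>.
\<close>

lemma fibre_spectrum_subset:
  assumes a: "a \<in> fibre B v"
  shows "fibre_spectrum B v a \<subseteq> fibre_spectrum C w (T a)"
proof -
  have mult_eq: "unitization_mult B (a, z) (b, y) = (bzero B v, 1)"
    if "a \<in> fibre B v" "b \<in> fibre B v"
      and "unitization_mult C (T a, z) (T b, y) = (bzero C w, 1)" for a b z y
    using that
    by (simp add: unitization_mult_def closed mult_fibre
             flip: T_mult T_scale T_add T_zero T_eq_iff)
  show ?thesis
  proof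
    fix z assume z: "z \<in> fibre_spectrum B v a"
    show "z \<in> fibre_spectrum C w (T a)"
    proof (rule ccontr)
      assume "z \<notin> fibre_spectrum C w (T a)"
      then obtain b y where "b \<in> fibre B v"
          "unitization_mult C (T a, - z) (T b, y) = (bzero C w, 1)"
          "unitization_mult C (T b, y) (T a, - z) = (bzero C w, 1)"
        unfolding fibre_spectrum_def T_image[symmetric] by auto
      then have "z \<notin> fibre_spectrum B v a"
        using mult_eq a unfolding fibre_spectrum_def by blast
      then show False using z by simp
    qed
  qed
qed

lemma fibre_positive_transfer:
  assumes a: "a \<in> fibre B v" and "fibre_positive C w (T a)"
  shows "fibre_positive B v a"
  using assms fibre_spectrum_subset[OF a]
  by (auto simp: fibre_positive_def star_fibre simp flip: T_star T_eq_iff)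

end

section \<open>Partial operations and operations on fibres\<close>

text \<open>
  Composition and the other partial operations are only continuous on a subspace of a product; this
  rule and the next one reduce their use to a pointwise check that the arguments are in the domain.
\<close>

lemma continuous_map_binop:
  assumes "continuous_map (subtopology (prod_topology Y Z) D) W (\<lambda>(a, b). m a b)"
    and "continuous_map X Y f" "continuous_map X Z g"
    and "\<And>x. x \<in> topspace X \<Longrightarrow> (f x, g x) \<in> D"
  shows "continuous_map X W (\<lambda>x. m (f x) (g x))"
proof -
  have "continuous_map X (subtopology (prod_topology Y Z) D) (\<lambda>x. (f x, g x))"
    using assms by (auto simp: continuous_map_in_subtopology intro: continuous_map_pairedI)
  from continuous_map_compose[OF this assms(1)] show ?thesis by (simp add: o_def)
qed

lemma binop_closed:
  assumes "continuous_map (subtopology (prod_topology Y Z) D) W (\<lambda>(a, b). m a b)"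
    and "a \<in> topspace Y" "b \<in> topspace Z" "(a, b) \<in> D"
  shows "m a b \<in> topspace W"
  using continuous_map_funspace[OF assms(1)] assms(2-) by (force simp: Pi_iff)

lemma (in complex_banach_space) diff_eq_zero_imp_eq:
  assumes "a \<in> V" "b \<in> V" "add a (scale (-1) b) = zero"
  shows "a = b"
proof -
  have "a = add a (add (scale (-1) b) b)"
    using assms by (metis add_commute add_minus add_zero scale_closed)
  also have "\<dots> = add (add a (scale (-1) b)) b"
    by (rule add_assoc[symmetric]) (use assms scale_closed in auto)
  also have "\<dots> = b"
    using assms by (metis add_commute add_zero zero_closed)
  finally show ?thesis .
qed

lemma (in complex_banach_space) scale_zero:
  assumes "a \<in> V"
  shows "scale 0 a = zero"
  using add_scale[OF assms, of 1 "-1"] add_minus[OF assms] one_scale[OF assms] by simp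

context usc_banach_bundle
begin

lemma proj_arrows: "b \<in> total_space B \<Longrightarrow> proj B b \<in> arrows G"
  using surj_proj by blast

lemma bcomposable_iff: "(a, b) \<in> bcomposable G B \<longleftrightarrow>
    a \<in> total_space B \<and> b \<in> total_space B \<and> src G (proj B a) = rng G (proj B b)"
  by (auto simp: bcomposable_def composable_def proj_arrows)

lemma fibre_add:
  assumes "a \<in> total_space B" "b \<in> total_space B" "proj B a = proj B b"
  shows "badd B a b \<in> total_space B" "proj B (badd B a b) = proj B b"
  using complex_banach_space.add_closed[OF banach_fibre, of "proj B b" a b] assms
  by (auto simp: fibre_def proj_arrows)

lemma fibre_scale:
  assumes "b \<in> total_space B"
  shows "bscale B z b \<in> total_space B" "proj B (bscale B z b) = proj B b"
  using complex_banach_space.scale_closed[OF banach_fibre, of "proj B b" b z] assms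
  by (auto simp: fibre_def proj_arrows)

lemma fibre_zero:
  assumes "x \<in> arrows G"
  shows "bzero B x \<in> total_space B" "proj B (bzero B x) = x"
  using complex_banach_space.zero_closed[OF banach_fibre, of x] assms
  by (auto simp: fibre_def)

lemma scale_0: "b \<in> total_space B \<Longrightarrow> bscale B 0 b = bzero B (proj B b)"
  using complex_banach_space.scale_zero[OF banach_fibre, of "proj B b" b]
  by (auto simp: fibre_def proj_arrows)

lemma norm_nonneg: "b \<in> total_space B \<Longrightarrow> 0 \<le> bnorm B b"
  using complex_banach_space.norm_nonneg[OF banach_fibre, of "proj B b" b]
  by (auto simp: fibre_def proj_arrows)

lemma continuous_map_badd:
  assumes "continuous_map X (btop B) f" "continuous_map X (btop B) g"
    and "\<And>x. x \<in> topspace X \<Longrightarrow> proj B (f x) = proj B (g x)"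
  shows "continuous_map X (btop B) (\<lambda>x. badd B (f x) (g x))"
  by (rule continuous_map_binop[OF continuous_add assms(1,2)]) (use assms(3) in auto)

end

context fell_bundle
begin

lemma mult_closed: "(a, b) \<in> bcomposable G B \<Longrightarrow> bmult B a b \<in> total_space B"
  using binop_closed[OF continuous_bmult, of a b]
  by (auto simp: bcomposable_def total_space_def)

lemma star_closed: "b \<in> total_space B \<Longrightarrow> bstar B b \<in> total_space B"
  using continuous_map_funspace[OF continuous_bstar] by (auto simp: total_space_def)

lemma continuous_map_bmult:
  assumes "continuous_map X (btop B) f" "continuous_map X (btop B) g"
    and "\<And>x. x \<in> topspace X \<Longrightarrow> (f x, g x) \<in> bcomposable G B"
  shows "continuous_map X (btop B) (\<lambda>x. bmult B (f x) (g x))"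
  by (rule continuous_map_binop[OF continuous_bmult assms])

end

section \<open>Transport of structure\<close>

text \<open>
  Let \<open>T\<close> be a homeomorphism from a space with bundle operations onto a Fell bundle which preserves
  all operations, and let the operations be closed where they are supposed to be defined.  Closedness
  has to be assumed, since \<open>T\<close> says nothing about values outside of the total space.  Then every
  axiom of a Fell bundle follows by applying \<open>T\<close> to it.
\<close>

locale fell_bundle_transport = K: abstract_groupoid K + C: fell_bundle K C
  for K :: "'x groupoid" and C :: "('x, 'c) bundle_data" +
  fixes B :: "('x, 'b) bundle_data" and T :: "'b \<Rightarrow> 'c" and S :: "'c \<Rightarrow> 'b"
  assumes homeo: "homeomorphic_maps (btop B) (btop C) T S"
    and T_proj: "b \<in> total_space B \<Longrightarrow> proj C (T b) = proj B b"
    and T_norm: "b \<in> total_space B \<Longrightarrow> bnorm C (T b) = bnorm B b"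
    and zero_closed: "x \<in> arrows K \<Longrightarrow> bzero B x \<in> total_space B"
    and T_zero: "x \<in> arrows K \<Longrightarrow> T (bzero B x) = bzero C x"
    and add_closed: "\<lbrakk>a \<in> total_space B; b \<in> total_space B; proj B a = proj B b\<rbrakk> \<Longrightarrow>
      badd B a b \<in> total_space B"
    and T_add: "\<lbrakk>a \<in> total_space B; b \<in> total_space B; proj B a = proj B b\<rbrakk> \<Longrightarrow>
      T (badd B a b) = badd C (T a) (T b)"
    and scale_closed: "b \<in> total_space B \<Longrightarrow> bscale B z b \<in> total_space B"
    and T_scale: "b \<in> total_space B \<Longrightarrow> T (bscale B z b) = bscale C z (T b)"
    and mult_closed: "(a, b) \<in> bcomposable K B \<Longrightarrow> bmult B a b \<in> total_space B"
    and T_mult: "(a, b) \<in> bcomposable K B \<Longrightarrow> T (bmult B a b) = bmult C (T a) (T b)"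
    and star_closed: "b \<in> total_space B \<Longrightarrow> bstar B b \<in> total_space B"
    and T_star: "b \<in> total_space B \<Longrightarrow> T (bstar B b) = bstar C (T b)"
begin

lemma T_total: "b \<in> total_space B \<Longrightarrow> T b \<in> total_space C"
  and S_total: "c \<in> total_space C \<Longrightarrow> S c \<in> total_space B"
  and S_T: "b \<in> total_space B \<Longrightarrow> S (T b) = b"
  and T_S: "c \<in> total_space C \<Longrightarrow> T (S c) = c"
  using homeo by (auto simp: homeomorphic_maps_def total_space_def continuous_map_def)

lemma continuous_T: "continuous_map (btop B) (btop C) T"
  and continuous_S: "continuous_map (btop C) (btop B) S"
  using homeo by (auto simp: homeomorphic_maps_def)

lemma bij_T: "bij_betw T (total_space B) (total_space C)"
  by (rule bij_betw_byWitness[where f' = S]) (auto simp: T_total S_total S_T T_S)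

lemma proj_S: "c \<in> total_space C \<Longrightarrow> proj B (S c) = proj C c"
  using T_proj[OF S_total, of c] by (simp add: T_S)

lemma eqI: "\<lbrakk>T a = T b; a \<in> total_space B; b \<in> total_space B\<rbrakk> \<Longrightarrow> a = b"
  by (metis S_T)

lemma comp_T: "(a, b) \<in> bcomposable K B \<Longrightarrow> (T a, T b) \<in> bcomposable K C"
  by (simp add: bcomposable_def T_total T_proj)

lemma proj_zero: "x \<in> arrows K \<Longrightarrow> proj B (bzero B x) = x"
  using T_proj[OF zero_closed, of x] C.fibre_zero(2)[of x] by (simp add: T_zero)

lemma proj_add: "\<lbrakk>a \<in> total_space B; b \<in> total_space B; proj B a = proj B b\<rbrakk> \<Longrightarrow>
    proj B (badd B a b) = proj B b"
  using T_proj[OF add_closed, of a b] C.fibre_add(2)[of "T a" "T b"]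
  by (simp add: T_add T_total T_proj)

lemma proj_scale: "b \<in> total_space B \<Longrightarrow> proj B (bscale B z b) = proj B b"
  using T_proj[OF scale_closed, of b z] C.fibre_scale(2)[of "T b" z]
  by (simp add: T_scale T_total T_proj)

lemma proj_mult: "(a, b) \<in> bcomposable K B \<Longrightarrow>
    proj B (bmult B a b) = gmult K (proj B a) (proj B b)"
  using T_proj[OF mult_closed, of a b] C.proj_mult[OF comp_T, of a b]
  by (simp add: T_mult) (simp add: bcomposable_def T_proj)

lemma proj_star: "b \<in> total_space B \<Longrightarrow> proj B (bstar B b) = ginv K (proj B b)"
  using T_proj[OF star_closed, of b] C.proj_star[of "T b"]
  by (simp add: T_star T_total T_proj)

lemma fibre_iso:
  assumes "x \<in> arrows K"
  shows "fibre_iso B x C x T"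
proof
  show "T ` fibre B x = fibre C x"
  proof
    show "fibre C x \<subseteq> T ` fibre B x"
    proof
      fix c assume "c \<in> fibre C x"
      then show "c \<in> T ` fibre B x"
        by (intro image_eqI[of _ T "S c"]) (auto simp: fibre_def S_total T_S proj_S)
    qed
  qed (auto simp: fibre_def T_total T_proj)
  show "inj_on T (fibre B x)"
    by (auto simp: fibre_def inj_on_def intro: eqI)
  show "bzero B x \<in> fibre B x" "T (bzero B x) = bzero C x"
    using assms by (simp_all add: fibre_def zero_closed proj_zero T_zero)
  fix a z assume "a \<in> fibre B x"
  then have a: "a \<in> total_space B" "proj B a = x"
    by (auto simp: fibre_def)
  show "bscale B z a \<in> fibre B x" "T (bscale B z a) = bscale C z (T a)"
    "bnorm C (T a) = bnorm B a"
    using a by (simp_all add: fibre_def scale_closed proj_scale T_scale T_norm)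
  fix b assume "b \<in> fibre B x"
  then have b: "b \<in> total_space B" "proj B b = x"
    by (auto simp: fibre_def)
  show "badd B a b \<in> fibre B x" "T (badd B a b) = badd C (T a) (T b)"
    using a b by (simp_all add: fibre_def add_closed proj_add T_add)
qed

lemma fibre_algebra_iso:
  assumes "v \<in> units K"
  shows "fibre_algebra_iso B v C v T"
proof -
  note v = K.unitD[OF assms]
  interpret fibre_iso B v C v T
    by (rule fibre_iso) (rule v)
  show ?thesis
  proof
    fix a assume "a \<in> fibre B v"
    then have a: "a \<in> total_space B" "proj B a = v"
      by (auto simp: fibre_def)
    show "bstar B a \<in> fibre B v"
      using a v by (simp add: fibre_def star_closed proj_star)
    show "T (bstar B a) = bstar C (T a)"
      using a by (simp add: T_star)
    fix b assume "b \<in> fibre B v"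
    then have b: "b \<in> total_space B" "proj B b = v"
      by (auto simp: fibre_def)
    have ab: "(a, b) \<in> bcomposable K B"
      using a b v by (simp add: bcomposable_def composable_def)
    show "bmult B a b \<in> fibre B v"
      using a b v mult_closed[OF ab] proj_mult[OF ab] by (simp add: fibre_def)
    show "T (bmult B a b) = bmult C (T a) (T b)"
      using ab by (rule T_mult)
  qed
qed

lemma continuous_binop:
  assumes "continuous_map (subtopology (prod_topology (btop C) (btop C)) E) (btop C)
      (\<lambda>(a, b). n a b)"
    and "\<And>a b. \<lbrakk>a \<in> total_space B; b \<in> total_space B; (a, b) \<in> D\<rbrakk> \<Longrightarrow>
      (T a, T b) \<in> E \<and> m a b \<in> total_space B \<and> T (m a b) = n (T a) (T b)"
  shows "continuous_map (subtopology (prod_topology (btop B) (btop B)) D) (btop B)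
      (\<lambda>(a, b). m a b)"
proof -
  let ?X = "subtopology (prod_topology (btop B) (btop B)) D"
  have "continuous_map ?X (btop C) (\<lambda>p. n (T (fst p)) (T (snd p)))"
  proof (rule continuous_map_binop[OF assms(1)])
    show "continuous_map ?X (btop C) (\<lambda>p. T (fst p))"
      using continuous_map_compose[OF continuous_map_from_subtopology[OF continuous_map_fst]
        continuous_T] by (simp add: o_def)
    show "continuous_map ?X (btop C) (\<lambda>p. T (snd p))"
      using continuous_map_compose[OF continuous_map_from_subtopology[OF continuous_map_snd]
        continuous_T] by (simp add: o_def)
    show "(T (fst p), T (snd p)) \<in> E" if "p \<in> topspace ?X" for p
      using that assms(2)[of "fst p" "snd p"] by (auto simp: total_space_def)
  qed
  from continuous_map_compose[OF this continuous_S]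
  show ?thesis
  proof (rule continuous_map_eq)
    fix p assume "p \<in> topspace ?X"
    then have "T (m (fst p) (snd p)) = n (T (fst p)) (T (snd p))" "m (fst p) (snd p) \<in> total_space B"
      using assms(2)[of "fst p" "snd p"] by (auto simp: total_space_def)
    then show "(S \<circ> (\<lambda>p. n (T (fst p)) (T (snd p)))) p = (\<lambda>(a, b). m a b) p"
      using S_T[of "m (fst p) (snd p)"] by (simp add: case_prod_beta)
  qed
qed

lemma continuous_unop:
  assumes "continuous_map (btop C) (btop C) n"
    and "\<And>b. b \<in> total_space B \<Longrightarrow> m b \<in> total_space B \<and> T (m b) = n (T b)"
  shows "continuous_map (btop B) (btop B) m"
  using continuous_map_compose[OF continuous_map_compose[OF continuous_T assms(1)] continuous_S]
proof (rule continuous_map_eq)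
  fix b assume "b \<in> topspace (btop B)"
  then show "(S \<circ> (n \<circ> T)) b = m b"
    using assms(2)[of b] S_T[of "m b"] by (simp add: total_space_def)
qed

lemma usc_banach_bundle: "usc_banach_bundle K B"
proof (rule usc_banach_bundle.intro)
  show "continuous_map (btop B) (gtop K) (proj B)"
    using continuous_map_compose[OF continuous_T C.continuous_proj]
    by (rule continuous_map_eq) (simp add: T_proj total_space_def)
  have "open_map (btop B) (btop C) T"
    using homeo homeomorphic_imp_open_map homeomorphic_maps_imp_map by blast
  from open_map_compose[OF this C.open_proj]
  show "open_map (btop B) (gtop K) (proj B)"
    by (rule open_map_eq) (simp add: T_proj total_space_def)
  show "proj B ` total_space B = arrows K"
    unfolding C.surj_proj[symmetric] bij_betw_imp_surj_on[OF bij_T, symmetric]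
    by (auto simp: T_proj image_image)
  show "complex_banach_space (fibre B x) (badd B) (bscale B) (bzero B x) (bnorm B)"
    if "x \<in> arrows K" for x
    by (rule fibre_iso.complex_banach_space_transfer[OF fibre_iso[OF that] C.banach_fibre[OF that]])
  have "{b \<in> total_space B. bnorm B b < t} =
      {b \<in> topspace (btop B). T b \<in> {c \<in> total_space C. bnorm C c < t}}" for t
    by (auto simp: T_norm T_total simp flip: total_space_def)
  then show "openin (btop B) {b \<in> total_space B. bnorm B b < t}" for t
    using openin_continuous_map_preimage[OF continuous_T C.usc_norm] by simp
  show "continuous_map (subtopology (prod_topology (btop B) (btop B)) {(a, b). proj B a = proj B b})
      (btop B) (\<lambda>(a, b). badd B a b)"
    by (rule continuous_binop[OF C.continuous_add]) (auto simp: T_proj add_closed T_add)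
  show "continuous_map (btop B) (btop B) (bscale B z)" for z
    by (rule continuous_unop[OF C.continuous_scale]) (simp add: scale_closed T_scale)
  \<comment> \<open>The filter is pushed forward along \<open>T\<close>, and its limit is pulled back along \<open>S\<close>.\<close>
  show "limitin (btop B) (\<lambda>b. b) (bzero B x) F"
    if x: "x \<in> arrows K" and F: "eventually (\<lambda>b. b \<in> total_space B) F"
      and lim: "limitin (gtop K) (proj B) x F" "(bnorm B \<longlongrightarrow> 0) F" for x F
  proof -
    have "eventually (\<lambda>c. c \<in> total_space C) (filtermap T F)"
      unfolding eventually_filtermap by (rule eventually_mono[OF F]) (rule T_total)
    moreover have "limitin (gtop K) (proj C \<circ> T) x F"
      using lim(1) by (rule limitin_transform_eventually[rotated])
        (rule eventually_mono[OF F], simp add: T_proj)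
    then have "limitin (gtop K) (proj C) x (filtermap T F)"
      by (simp add: limitin_def eventually_filtermap)
    moreover have "((\<lambda>b. bnorm C (T b)) \<longlongrightarrow> 0) F"
      using lim(2) by (rule Lim_transform_eventually)
        (rule eventually_mono[OF F], simp add: T_norm)
    then have "(bnorm C \<longlongrightarrow> 0) (filtermap T F)"
      by (simp add: filterlim_filtermap)
    ultimately have "limitin (btop C) (\<lambda>c. c) (bzero C x) (filtermap T F)"
      by (rule C.small_norm[OF x])
    then have "limitin (btop C) T (bzero C x) F"
      by (simp add: limitin_def eventually_filtermap)
    from continuous_map_limit[OF continuous_S this]
    have "limitin (btop B) (S \<circ> T) (bzero B x) F"
      by (metis S_T T_zero x zero_closed)
    then show ?thesis
      by (rule limitin_transform_eventually[rotated])
        (rule eventually_mono[OF F], simp add: S_T)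
  qed
qed

sublocale B: usc_banach_bundle K B
  by (rule usc_banach_bundle)

lemma fell_bundle: "fell_bundle K B"
proof (intro fell_bundle.intro fell_bundle_axioms.intro B.usc_banach_bundle_axioms)
  show "continuous_map (subtopology (prod_topology (btop B) (btop B)) (bcomposable K B))
      (btop B) (\<lambda>(a, b). bmult B a b)"
    by (rule continuous_binop[OF C.continuous_bmult]) (auto simp: comp_T mult_closed T_mult)
  show "continuous_map (btop B) (btop B) (bstar B)"
    by (rule continuous_unop[OF C.continuous_bstar]) (simp add: star_closed T_star)
next
  note [simp] = B.bcomposable_iff C.bcomposable_iff T_total T_proj T_norm B.proj_arrows
    B.fibre_add B.fibre_scale star_closed T_add T_scale T_star proj_star
    mult_closed[unfolded B.bcomposable_iff] T_mult[unfolded B.bcomposable_iff]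
    proj_mult[unfolded B.bcomposable_iff]
  fix a :: 'b and z
  assume a: "a \<in> total_space B"
  show "proj B (bstar B a) = ginv K (proj B a)"
    using a by simp
  show "bstar B (bstar B a) = a"
    by (rule eqI) (use a in \<open>simp_all add: C.star_star\<close>)
  show "bstar B (bscale B z a) = bscale B (cnj z) (bstar B a)"
    by (rule eqI) (use a in \<open>simp_all add: C.star_scale\<close>)
  show "(bnorm B (bstar B a))\<^sup>2 = (bnorm B a)\<^sup>2"
    using a C.norm_star[of "T a"] T_norm[of "bstar B a"] by simp
  show "bnorm B (bmult B (bstar B a) a) = (bnorm B a)\<^sup>2"
    using a C.norm_star_mult[of "T a"] T_norm[of "bmult B (bstar B a) a"] by simp
  have "src K (proj B a) \<in> units K"
    using a by simp
  then interpret fibre_algebra_iso B "src K (proj B a)" C "src K (proj B a)" T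
    by (rule fibre_algebra_iso)
  show "fibre_positive B (src K (proj B a)) (bmult B (bstar B a) a)"
    by (rule fibre_positive_transfer)
      (use a C.star_mult_positive[of "T a"] in \<open>simp_all add: fibre_def\<close>)
next
  note [simp] = B.bcomposable_iff C.bcomposable_iff T_total T_proj T_norm B.proj_arrows
    B.fibre_add B.fibre_scale star_closed T_add T_scale T_star proj_star
    mult_closed[unfolded B.bcomposable_iff] T_mult[unfolded B.bcomposable_iff]
    proj_mult[unfolded B.bcomposable_iff]
  fix a b :: 'b
  show "bstar B (badd B a b) = badd B (bstar B a) (bstar B b)"
    if "a \<in> total_space B" "b \<in> total_space B" "proj B a = proj B b"
    by (rule eqI) (use that in \<open>simp_all add: C.star_add\<close>)
  assume ab: "(a, b) \<in> bcomposable K B"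
  show "proj B (bmult B a b) = gmult K (proj B a) (proj B b)"
    using ab by simp
  show "bmult B (bscale B z a) b = bscale B z (bmult B a b)" for z
    by (rule eqI) (use ab in \<open>simp_all add: C.mult_scale_left\<close>)
  show "bmult B a (bscale B z b) = bscale B z (bmult B a b)" for z
    by (rule eqI) (use ab in \<open>simp_all add: C.mult_scale_right\<close>)
  show "bnorm B (bmult B a b) \<le> bnorm B a * bnorm B b"
    using ab C.norm_mult[of "T a" "T b"] T_norm[of "bmult B a b"] by simp
  show "bstar B (bmult B a b) = bmult B (bstar B b) (bstar B a)"
    by (rule eqI) (use ab in \<open>simp_all add: C.star_mult\<close>)
  show "bmult B (badd B a a') b = badd B (bmult B a b) (bmult B a' b)"
    if "(a', b) \<in> bcomposable K B" "proj B a = proj B a'" for a'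
    by (rule eqI) (use ab that in \<open>simp_all add: C.mult_add_left\<close>)
  show "bmult B a (badd B b b') = badd B (bmult B a b) (bmult B a b')"
    if "(a, b') \<in> bcomposable K B" "proj B b = proj B b'" for b'
    by (rule eqI) (use ab that in \<open>simp_all add: C.mult_add_right\<close>)
  show "bmult B (bmult B a b) c = bmult B a (bmult B b c)"
    if "(b, c) \<in> bcomposable K B" for c
    by (rule eqI) (use ab that in \<open>simp_all add: C.bmult_assoc\<close>)
qed

end

section \<open>Pullbacks\<close>

text \<open>
  The map \<open>f\<close> is a continuous homomorphism; its laws ensure that the set of pairs \<open>(x, c)\<close> with
  \<open>c\<close> over \<open>f x\<close> is closed under the componentwise product and involution.
\<close>

locale fell_bundle_pullback = G: etale_groupoid G + C: fell_bundle K C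
  for G :: "'a groupoid" and K :: "'x groupoid" and C :: "('x, 'c) bundle_data" +
  fixes f :: "'a \<Rightarrow> 'x"
  assumes continuous_f: "continuous_map (gtop G) (gtop K) f"
    and f_rng: "x \<in> arrows G \<Longrightarrow> rng K (f x) = f (rng G x)"
    and f_src: "x \<in> arrows G \<Longrightarrow> src K (f x) = f (src G x)"
    and f_mult: "\<lbrakk>x \<in> arrows G; y \<in> arrows G; src G x = rng G y\<rbrakk> \<Longrightarrow>
      f (gmult G x y) = gmult K (f x) (f y)"
    and f_inv: "x \<in> arrows G \<Longrightarrow> f (ginv G x) = ginv K (f x)"
begin

abbreviation P where "P \<equiv> pullback G f C"

lemma f_arrows: "x \<in> arrows G \<Longrightarrow> f x \<in> arrows K"
  using continuous_map_funspace[OF continuous_f] by (auto simp: arrows_def)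

lemma pullback_simps [simp]:
  "proj P p = fst p"
  "badd P (x, c) (y, d) = (x, badd C c d)"
  "bscale P z (x, c) = (x, bscale C z c)"
  "bzero P x = (x, bzero C (f x))"
  "bnorm P (x, c) = bnorm C c"
  "bmult P (x, c) (y, d) = (gmult G x y, bmult C c d)"
  "bstar P (x, c) = (ginv G x, bstar C c)"
  by (simp_all add: pullback_def)

lemma btop_P: "btop P = subtopology (prod_topology (gtop G) (btop C)) {(x, c). f x = proj C c}"
  by (simp add: pullback_def)

lemma total_P [simp]: "(x, c) \<in> total_space P \<longleftrightarrow>
    x \<in> arrows G \<and> c \<in> total_space C \<and> proj C c = f x"
  by (auto simp: total_space_def arrows_def btop_P)

lemma fibre_P [simp]: "(x, c) \<in> fibre P y \<longleftrightarrow>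
    x = y \<and> y \<in> arrows G \<and> c \<in> total_space C \<and> proj C c = f y"
  by (auto simp: fibre_def)

lemma continuous_fst_P: "continuous_map (btop P) (gtop G) fst"
  and continuous_snd_P: "continuous_map (btop P) (btop C) snd"
  unfolding btop_P
  by (intro continuous_map_from_subtopology continuous_map_fst continuous_map_snd)+

lemma continuous_map_into_P:
  assumes "continuous_map X (gtop G) g" "continuous_map X (btop C) h"
    and "\<And>x. x \<in> topspace X \<Longrightarrow> f (g x) = proj C (h x)"
  shows "continuous_map X (btop P) (\<lambda>x. (g x, h x))"
  unfolding btop_P using assms
  by (auto simp: continuous_map_in_subtopology intro: continuous_map_pairedI)

lemma fibre_iso: "x \<in> arrows G \<Longrightarrow> fibre_iso P x C (f x) snd"
proof
  assume x: "x \<in> arrows G"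
  show "snd ` fibre P x = fibre C (f x)"
  proof
    show "fibre C (f x) \<subseteq> snd ` fibre P x"
    proof
      fix c assume "c \<in> fibre C (f x)"
      then show "c \<in> snd ` fibre P x"
        using x by (intro image_eqI[of _ _ "(x, c)"]) (auto simp: fibre_def)
    qed
  qed (auto simp: fibre_def)
  show "inj_on snd (fibre P x)"
    by (auto simp: inj_on_def)
  show "bzero P x \<in> fibre P x" "snd (bzero P x) = bzero C (f x)"
    using x C.fibre_zero[OF f_arrows] by auto
qed (auto simp: C.fibre_add C.fibre_scale)

text \<open>
  The pullback of an open map is open: near a point of a box \<open>U \<times> V\<close>, the image contains
  \<open>U \<inter> f\<^sup>-\<^sup>1(q(V))\<close> where \<open>q\<close> is the projection of the given bundle, and \<open>q(V)\<close> is open.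
\<close>

lemma open_proj_P: "open_map (btop P) (gtop G) fst"
  unfolding open_map_def
proof (intro allI impI)
  fix W assume W: "openin (btop P) W"
  then obtain W' where W': "openin (prod_topology (gtop G) (btop C)) W'"
    and eq: "W = W' \<inter> {(x, c). f x = proj C c}"
    by (auto simp: btop_P openin_subtopology)
  show "openin (gtop G) (fst ` W)"
  proof (subst openin_subopen, intro ballI)
    fix x assume "x \<in> fst ` W"
    then obtain c where xc: "(x, c) \<in> W'" "f x = proj C c"
      using eq by auto
    with W' obtain U V where UV: "openin (gtop G) U" "openin (btop C) V" "x \<in> U" "c \<in> V"
      "U \<times> V \<subseteq> W'"
      by (metis openin_prod_topology_alt)
    let ?U = "U \<inter> {y \<in> topspace (gtop G). f y \<in> proj C ` V}"
    have "openin (gtop K) (proj C ` V)"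
      using C.open_proj UV by (auto simp: open_map_def)
    then have "openin (gtop G) ?U"
      using UV openin_continuous_map_preimage[OF continuous_f] by blast
    moreover have "x \<in> ?U"
      using UV xc openin_subset by fastforce
    moreover have "?U \<subseteq> fst ` W"
    proof
      fix y assume "y \<in> ?U"
      then obtain d where "y \<in> U" "d \<in> V" "f y = proj C d"
        by auto
      then show "y \<in> fst ` W"
        using UV(5) eq by (intro image_eqI[of _ _ "(y, d)"]) auto
    qed
    ultimately show "\<exists>T. openin (gtop G) T \<and> x \<in> T \<and> T \<subseteq> fst ` W"
      by blast
  qed
qed

lemma usc_banach_bundle: "usc_banach_bundle G P"
proof (rule usc_banach_bundle.intro)
  show "continuous_map (btop P) (gtop G) (proj P)" "open_map (btop P) (gtop G) (proj P)"
    using continuous_fst_P open_proj_P by (simp_all add: pullback_def)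
  show "proj P ` total_space P = arrows G"
  proof
    show "arrows G \<subseteq> proj P ` total_space P"
    proof
      fix x assume x: "x \<in> arrows G"
      then obtain c where "c \<in> total_space C" "proj C c = f x"
        using C.surj_proj f_arrows by (metis imageE)
      then show "x \<in> proj P ` total_space P"
        using x by (intro image_eqI[of _ _ "(x, c)"]) auto
    qed
  qed auto
  show "complex_banach_space (fibre P x) (badd P) (bscale P) (bzero P x) (bnorm P)"
    if "x \<in> arrows G" for x
    using fibre_iso.complex_banach_space_transfer[OF fibre_iso[OF that]
        C.banach_fibre[OF f_arrows[OF that]]] .
  have "{p \<in> total_space P. bnorm P p < t} =
      {p \<in> topspace (btop P). snd p \<in> {c \<in> total_space C. bnorm C c < t}}" for t
    by (auto simp flip: total_space_def)
  then show "openin (btop P) {p \<in> total_space P. bnorm P p < t}" for t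
    using openin_continuous_map_preimage[OF continuous_snd_P C.usc_norm] by simp
  show "continuous_map (subtopology (prod_topology (btop P) (btop P)) {(a, b). proj P a = proj P b})
      (btop P) (\<lambda>(a, b). badd P a b)" (is "continuous_map ?X _ _")
  proof -
    have c: "continuous_map ?X (btop P) fst" "continuous_map ?X (btop P) snd"
      by (intro continuous_map_from_subtopology continuous_map_fst continuous_map_snd)+
    have "continuous_map ?X (btop P) (\<lambda>p. (fst (fst p), badd C (snd (fst p)) (snd (snd p))))"
      using continuous_map_compose[OF c(1) continuous_fst_P]
        continuous_map_compose[OF c(1) continuous_snd_P]
        continuous_map_compose[OF c(2) continuous_snd_P]
      by (intro continuous_map_into_P C.continuous_map_badd)
        (auto simp: o_def C.fibre_add simp flip: total_space_def)
    then show ?thesis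
      by (rule continuous_map_eq) (auto simp flip: total_space_def)
  qed
  show "continuous_map (btop P) (btop P) (bscale P z)" for z
  proof -
    have "continuous_map (btop P) (btop P) (\<lambda>p. (fst p, bscale C z (snd p)))"
      using continuous_fst_P continuous_map_compose[OF continuous_snd_P C.continuous_scale]
      by (intro continuous_map_into_P)
        (auto simp: o_def C.fibre_scale simp flip: total_space_def)
    then show ?thesis
      by (rule continuous_map_eq) (auto simp flip: total_space_def)
  qed
  show "limitin (btop P) (\<lambda>p. p) (bzero P x) F"
    if x: "x \<in> arrows G" and F: "eventually (\<lambda>p. p \<in> total_space P) F"
      and lim: "limitin (gtop G) (proj P) x F" "(bnorm P \<longlongrightarrow> 0) F" for x F
  proof -
    have "eventually (\<lambda>c. c \<in> total_space C) (filtermap snd F)"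
      unfolding eventually_filtermap by (rule eventually_mono[OF F]) auto
    moreover have "limitin (gtop K) (\<lambda>p. proj C (snd p)) (f x) F"
      using continuous_map_limit[OF continuous_f lim(1)]
      by (rule limitin_transform_eventually[rotated]) (rule eventually_mono[OF F], auto)
    then have "limitin (gtop K) (proj C) (f x) (filtermap snd F)"
      by (simp add: limitin_def eventually_filtermap)
    moreover have "((\<lambda>p. bnorm C (snd p)) \<longlongrightarrow> 0) F"
      using lim(2) by (rule Lim_transform_eventually) (rule eventually_mono[OF F], auto)
    then have "(bnorm C \<longlongrightarrow> 0) (filtermap snd F)"
      by (simp add: filterlim_filtermap)
    ultimately have "limitin (btop C) (\<lambda>c. c) (bzero C (f x)) (filtermap snd F)"
      using C.small_norm f_arrows[OF x] by blast
    then have "limitin (btop C) snd (bzero C (f x)) F"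
      by (simp add: limitin_def eventually_filtermap)
    moreover have "limitin (gtop G) fst x F"
      using lim(1) by (simp add: pullback_def)
    moreover have "eventually (\<lambda>p. p \<in> {(x, c). f x = proj C c}) F"
      by (rule eventually_mono[OF F]) auto
    ultimately show ?thesis
      using C.fibre_zero[OF f_arrows[OF x]]
      by (simp add: btop_P limitin_subtopology limitin_pairwise o_def)
  qed
qed

sublocale P: usc_banach_bundle G P
  by (rule usc_banach_bundle)

lemma comp_P: "((x, c), (y, d)) \<in> bcomposable G P \<longleftrightarrow>
    (x, c) \<in> total_space P \<and> (y, d) \<in> total_space P \<and> src G x = rng G y"
  by (simp add: P.bcomposable_iff)

lemma comp_C: "((x, c), (y, d)) \<in> bcomposable G P \<Longrightarrow> (c, d) \<in> bcomposable K C"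
  by (simp add: comp_P C.bcomposable_iff f_rng f_src)

lemma fibre_algebra_iso:
  assumes "v \<in> units G"
  shows "fibre_algebra_iso P v C (f v) snd"
proof -
  note v = G.unitD[OF assms]
  interpret fibre_iso P v C "f v" snd
    by (rule fibre_iso) (rule v)
  show ?thesis
  proof
    fix a assume "a \<in> fibre P v"
    then obtain c where a: "a = (v, c)" "c \<in> total_space C" "proj C c = f v"
      by (cases a) auto
    show "bstar P a \<in> fibre P v" "snd (bstar P a) = bstar C (snd a)"
      using a v f_inv[of v] by (simp_all add: C.star_closed C.proj_star)
    fix b assume "b \<in> fibre P v"
    then obtain d where b: "b = (v, d)" "d \<in> total_space C" "proj C d = f v"
      by (cases b) auto
    have "(c, d) \<in> bcomposable K C"
      by (rule comp_C[of v _ v]) (use a b v in \<open>simp add: comp_P\<close>)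
    then show "bmult P a b \<in> fibre P v" "snd (bmult P a b) = bmult C (snd a) (snd b)"
      using a b v f_mult[of v v] by (simp_all add: C.mult_closed C.proj_mult)
  qed
qed

lemma fell_bundle: "fell_bundle G P"
proof (intro fell_bundle.intro fell_bundle_axioms.intro P.usc_banach_bundle_axioms)
  show "continuous_map (subtopology (prod_topology (btop P) (btop P)) (bcomposable G P))
      (btop P) (\<lambda>(a, b). bmult P a b)" (is "continuous_map ?X _ _")
  proof -
    have c: "continuous_map ?X (btop P) fst" "continuous_map ?X (btop P) snd"
      by (intro continuous_map_from_subtopology continuous_map_fst continuous_map_snd)+
    have "continuous_map ?X (btop P)
        (\<lambda>p. (gmult G (fst (fst p)) (fst (snd p)), bmult C (snd (fst p)) (snd (snd p))))"
    proof (intro continuous_map_into_P C.continuous_map_bmult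
        continuous_map_binop[OF G.continuous_mult])
      show "continuous_map ?X (gtop G) (\<lambda>p. fst (fst p))" "continuous_map ?X (gtop G) (\<lambda>p. fst (snd p))"
        "continuous_map ?X (btop C) (\<lambda>p. snd (fst p))" "continuous_map ?X (btop C) (\<lambda>p. snd (snd p))"
        using c continuous_map_compose[OF _ continuous_fst_P]
          continuous_map_compose[OF _ continuous_snd_P] by (auto simp: o_def)
      fix p assume p: "p \<in> topspace ?X"
      then obtain x c y d where eq: "p = ((x, c), (y, d))" and comp: "((x, c), (y, d)) \<in> bcomposable G P"
        by (cases p; cases "fst p"; cases "snd p") auto
      show "(snd (fst p), snd (snd p)) \<in> bcomposable K C"
        using comp_C[OF comp] eq by simp
      show "(fst (fst p), fst (snd p)) \<in> composable G"
        using comp eq by (simp add: bcomposable_def)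
      show "f (gmult G (fst (fst p)) (fst (snd p))) = proj C (bmult C (snd (fst p)) (snd (snd p)))"
        using comp eq C.proj_mult[OF comp_C[OF comp]] f_mult[of x y] by (simp add: comp_P)
    qed
    then show ?thesis
      by (rule continuous_map_eq) auto
  qed
  show "continuous_map (btop P) (btop P) (bstar P)"
  proof -
    have "continuous_map (btop P) (btop P) (\<lambda>p. (ginv G (fst p), bstar C (snd p)))"
      using continuous_map_compose[OF continuous_fst_P G.continuous_inv]
        continuous_map_compose[OF continuous_snd_P C.continuous_bstar]
      by (intro continuous_map_into_P)
        (auto simp: o_def C.proj_star f_inv simp flip: total_space_def)
    then show ?thesis
      by (rule continuous_map_eq) (auto simp flip: total_space_def)
  qed
next
  fix a :: "'a \<times> 'c" and z
  assume "a \<in> total_space P"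
  then obtain x c where a: "a = (x, c)" "x \<in> arrows G" "c \<in> total_space C" "proj C c = f x"
    by (cases a) auto
  show "proj P (bstar P a) = ginv G (proj P a)"
    using a by simp
  show "bstar P (bstar P a) = a"
    using a by (simp add: C.star_star)
  show "bstar P (bscale P z a) = bscale P (cnj z) (bstar P a)"
    using a by (simp add: C.star_scale)
  show "(bnorm P (bstar P a))\<^sup>2 = (bnorm P a)\<^sup>2"
    using a by (simp add: C.norm_star)
  show "bnorm P (bmult P (bstar P a) a) = (bnorm P a)\<^sup>2"
    using a by (simp add: C.norm_star_mult)
  interpret fibre_algebra_iso P "src G x" C "f (src G x)" snd
    by (rule fibre_algebra_iso) (use a in simp)
  have comp: "(bstar C c, c) \<in> bcomposable K C"
    by (rule comp_C[of "ginv G x" _ x]) (use a in \<open>simp add: comp_P C.star_closed C.proj_star f_inv\<close>)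
  have "proj C (bmult C (bstar C c) c) = f (src G x)"
    using a C.proj_mult[OF comp] f_mult[of "ginv G x" x] f_inv[of x] C.proj_star[of c] by simp
  then have "fibre_positive P (src G x) (bmult P (bstar P a) a)"
    by (intro fibre_positive_transfer)
      (use a C.star_mult_positive[of c] in \<open>simp_all add: C.mult_closed[OF comp] f_src\<close>)
  then show "fibre_positive P (src G (proj P a)) (bmult P (bstar P a) a)"
    using a by simp
next
  fix a b :: "'a \<times> 'c"
  show "bstar P (badd P a b) = badd P (bstar P a) (bstar P b)"
    if "a \<in> total_space P" "b \<in> total_space P" "proj P a = proj P b"
    using that by (cases a; cases b) (simp add: C.star_add)
  assume ab': "(a, b) \<in> bcomposable G P"
  then obtain x c y d where ab: "a = (x, c)" "b = (y, d)" "x \<in> arrows G" "c \<in> total_space C"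
    "proj C c = f x" "y \<in> arrows G" "d \<in> total_space C" "proj C d = f y" "src G x = rng G y"
    by (cases a; cases b) (auto simp: comp_P)
  have cd: "(c, d) \<in> bcomposable K C"
    using ab' ab(1,2) by (simp add: comp_C)
  show "proj P (bmult P a b) = gmult G (proj P a) (proj P b)"
    using ab by simp
  show "bmult P (bscale P z a) b = bscale P z (bmult P a b)" for z
    using ab C.mult_scale_left[OF cd] by simp
  show "bmult P a (bscale P z b) = bscale P z (bmult P a b)" for z
    using ab C.mult_scale_right[OF cd] by simp
  show "bnorm P (bmult P a b) \<le> bnorm P a * bnorm P b"
    using ab C.norm_mult[OF cd] by simp
  show "bstar P (bmult P a b) = bmult P (bstar P b) (bstar P a)"
    using ab C.star_mult[OF cd] G.inv_mult[of x y] by simp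
  show "bmult P (badd P a a') b = badd P (bmult P a b) (bmult P a' b)"
    if "(a', b) \<in> bcomposable G P" "proj P a = proj P a'" for a'
    using that ab C.mult_add_left[OF cd comp_C, of "fst a'" "snd a'" y]
    by (cases a') (simp add: comp_P)
  show "bmult P a (badd P b b') = badd P (bmult P a b) (bmult P a b')"
    if "(a, b') \<in> bcomposable G P" "proj P b = proj P b'" for b'
    using that ab C.mult_add_right[OF cd comp_C, of x "fst b'" "snd b'"]
    by (cases b') (simp add: comp_P)
  show "bmult P (bmult P a b) e = bmult P a (bmult P b e)"
    if "(b, e) \<in> bcomposable G P" for e
    using that ab C.bmult_assoc[OF cd comp_C, of y "fst e" "snd e"] G.assoc[of x y "fst e"]
    by (cases e) (simp add: comp_P)
qed

end

section \<open>Matched pairs and the Zappa-Szep product\<close>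

context matched_pair
begin

lemma act_arrow [simp]: "\<lbrakk>h \<in> arrows H; x \<in> arrows G; src H h = rng G x\<rbrakk> \<Longrightarrow> act h x \<in> arrows G"
  using binop_closed[OF continuous_act, of h x] by (simp add: arrows_def action_domain_def)

lemma res_arrow [simp]: "\<lbrakk>h \<in> arrows H; x \<in> arrows G; src H h = rng G x\<rbrakk> \<Longrightarrow> res h x \<in> arrows H"
  using binop_closed[OF continuous_res, of h x] by (simp add: arrows_def action_domain_def)

lemma ends_simps [simp]:
  assumes "h \<in> arrows H" "x \<in> arrows G" "src H h = rng G x"
  shows "rng G (act h x) = rng H h" "src H (res h x) = src G x"
    "src G (act h x) = rng H (res h x)"
  using assms by (simp_all add: action_domain_def rng_act src_res src_act)

lemma mult_act': "\<lbrakk>h \<in> arrows H; k \<in> arrows H; x \<in> arrows G; src H h = rng H k; src H k = rng G x\<rbrakk>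
    \<Longrightarrow> act (gmult H h k) x = act h (act k x)"
  and mult_res': "\<lbrakk>h \<in> arrows H; k \<in> arrows H; x \<in> arrows G; src H h = rng H k; src H k = rng G x\<rbrakk>
    \<Longrightarrow> res (gmult H h k) x = gmult H (res h (act k x)) (res k x)"
  and act_mult': "\<lbrakk>h \<in> arrows H; x \<in> arrows G; y \<in> arrows G; src H h = rng G x; src G x = rng G y\<rbrakk>
    \<Longrightarrow> act h (gmult G x y) = gmult G (act h x) (act (res h x) y)"
  and res_mult': "\<lbrakk>h \<in> arrows H; x \<in> arrows G; y \<in> arrows G; src H h = rng G x; src G x = rng G y\<rbrakk>
    \<Longrightarrow> res h (gmult G x y) = res (res h x) y"
  by (simp_all add: mult_act mult_res act_mult res_mult composable_def action_domain_def)

lemma unit_simps: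
  assumes "v \<in> units G"
  shows "v \<in> arrows G" "v \<in> arrows H" "rng G v = v" "src G v = v" "rng H v = v" "src H v = v"
    "ginv G v = v" "ginv H v = v" "gmult G v v = v" "gmult H v v = v"
  using G.unitD[OF assms] H.unitD[of v] assms by (auto simp: same_units)

lemma ends_units [simp]:
  "x \<in> arrows G \<Longrightarrow> rng G x \<in> units G" "x \<in> arrows G \<Longrightarrow> src G x \<in> units G"
  "h \<in> arrows H \<Longrightarrow> rng H h \<in> units G" "h \<in> arrows H \<Longrightarrow> src H h \<in> units G"
  using G.rng_unit G.src_unit H.rng_unit H.src_unit by (simp_all add: same_units)

lemma ends_cross [simp]:
  "x \<in> arrows G \<Longrightarrow> rng G x \<in> arrows H" "x \<in> arrows G \<Longrightarrow> src G x \<in> arrows H"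
  "x \<in> arrows G \<Longrightarrow> rng H (rng G x) = rng G x" "x \<in> arrows G \<Longrightarrow> src H (rng G x) = rng G x"
  "x \<in> arrows G \<Longrightarrow> rng H (src G x) = src G x" "x \<in> arrows G \<Longrightarrow> src H (src G x) = src G x"
  "h \<in> arrows H \<Longrightarrow> rng H h \<in> arrows G" "h \<in> arrows H \<Longrightarrow> src H h \<in> arrows G"
  "h \<in> arrows H \<Longrightarrow> rng G (rng H h) = rng H h" "h \<in> arrows H \<Longrightarrow> src G (rng H h) = rng H h"
  "h \<in> arrows H \<Longrightarrow> rng G (src H h) = src H h" "h \<in> arrows H \<Longrightarrow> src G (src H h) = src H h"
  by (simp_all add: unit_simps)

lemma inv_cross [simp]:
  "x \<in> arrows G \<Longrightarrow> ginv H (rng G x) = rng G x" "x \<in> arrows G \<Longrightarrow> ginv H (src G x) = src G x"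
  by (simp_all add: unit_simps)

lemma unit_mult:
  assumes "v \<in> units G"
  shows "\<lbrakk>x \<in> arrows G; rng G x = v\<rbrakk> \<Longrightarrow> gmult G v x = x"
    "\<lbrakk>x \<in> arrows G; src G x = v\<rbrakk> \<Longrightarrow> gmult G x v = x"
    "\<lbrakk>h \<in> arrows H; rng H h = v\<rbrakk> \<Longrightarrow> gmult H v h = h"
    "\<lbrakk>h \<in> arrows H; src H h = v\<rbrakk> \<Longrightarrow> gmult H h v = h"
  by auto

lemma unit_act': "\<lbrakk>v \<in> units G; x \<in> arrows G; rng G x = v\<rbrakk> \<Longrightarrow> act v x = x"
  using unit_act by auto

lemma res_unit': "\<lbrakk>v \<in> units G; h \<in> arrows H; src H h = v\<rbrakk> \<Longrightarrow> res h v = h"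
  using res_unit by auto

text \<open>
  Both this lemma and the next one are proved by showing that the element in question is idempotent:
  apply the rule for a product in \<open>H\<close> or in \<open>G\<close> to \<open>v v = v\<close>.
\<close>

lemma unit_res:
  assumes "v \<in> units G" "x \<in> arrows G" "rng G x = v"
  shows "res v x = src G x"
proof -
  note v = unit_simps[OF assms(1)]
  have "gmult H (res v x) (res v x) = res v x"
    using mult_res'[of v v x] assms v by (simp add: unit_act')
  moreover have "rng H (res v x) = src G x"
    using ends_simps(3)[of v x] assms v by (simp add: unit_act')
  ultimately show ?thesis
    using H.idempotent_imp_unit[of "res v x"] assms v by simp
qed

lemma act_unit:
  assumes "v \<in> units G" "h \<in> arrows H" "src H h = v"
  shows "act h v = rng H h"
proof -
  note v = unit_simps[OF assms(1)]
  have "gmult G (act h v) (act h v) = act h v"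
    using act_mult'[of h v v] assms v by (simp add: res_unit')
  moreover have "src G (act h v) = rng H h"
    using assms v by (simp add: res_unit')
  ultimately show ?thesis
    using G.idempotent_imp_unit[of "act h v"] assms v by simp
qed

lemma res_res_inv [simp]:
  assumes "h \<in> arrows H" "x \<in> arrows G" "src H h = rng G x"
  shows "res (res h x) (ginv G x) = h"
  using res_mult'[of h x "ginv G x"] assms by (simp add: res_unit')

text \<open>
  The product \<open>(h \<cdot> x) (h|\<^sub>x \<cdot> x\<^sup>-\<^sup>1) = h \<cdot> (x x\<^sup>-\<^sup>1)\<close> is \<open>h \<cdot> s(h)\<close>, hence the unit \<open>r(h)\<close>.
\<close>

lemma inv_act:
  assumes "h \<in> arrows H" "x \<in> arrows G" "src H h = rng G x"
  shows "ginv G (act h x) = act (res h x) (ginv G x)"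
proof (rule G.inverse_unique[symmetric])
  show "gmult G (act h x) (act (res h x) (ginv G x)) = rng G (act h x)"
    using act_mult'[of h x "ginv G x"] assms by (simp add: act_unit)
qed (use assms in simp_all)

abbreviation K where "K \<equiv> zappa_szep G H act res"

lemma zappa_szep_simps [simp]:
  "rng K (x, h) = (rng G x, rng G x)"
  "src K (x, h) = (src H h, src H h)"
  "gmult K (x, h) (y, g) = (gmult G x (act h y), gmult H (res h y) g)"
  "ginv K (x, h) = (act (ginv H h) (ginv G x), res (ginv H h) (ginv G x))"
  by (simp_all add: zappa_szep_def)

lemma gtop_K: "gtop K = subtopology (prod_topology (gtop G) (gtop H)) {(x, h). src G x = rng H h}"
  by (simp add: zappa_szep_def)

lemma arrows_K [simp]: "(x, h) \<in> arrows K \<longleftrightarrow> x \<in> arrows G \<and> h \<in> arrows H \<and> src G x = rng H h"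
  by (auto simp: arrows_def gtop_K)

sublocale K: abstract_groupoid K
proof
  fix p q r :: "'a \<times> 'a"
  assume "p \<in> arrows K"
  then obtain x h where p: "p = (x, h)" "x \<in> arrows G" "h \<in> arrows H" "src G x = rng H h"
    by (cases p) auto
  show "rng K p \<in> arrows K" "src K p \<in> arrows K" "rng K (rng K p) = rng K p"
    "src K (rng K p) = rng K p" "rng K (src K p) = src K p" "src K (src K p) = src K p"
    "ginv K p \<in> arrows K" "rng K (ginv K p) = src K p" "src K (ginv K p) = rng K p"
    using p by simp_all
  show "gmult K (rng K p) p = p" "gmult K p (src K p) = p"
    using p by (simp_all add: unit_act' unit_res act_unit res_unit unit_mult)
  show "gmult K p (ginv K p) = rng K p"
    using p mult_act'[of h "ginv H h" "ginv G x"] mult_res'[of h "ginv H h" "ginv G x"]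
    by (simp add: unit_act' unit_res)
  show "gmult K (ginv K p) p = src K p"
    using p act_mult'[of "ginv H h" "ginv G x" x] res_mult'[of "ginv H h" "ginv G x" x]
    by (simp add: act_unit res_unit')
  assume "q \<in> arrows K" "src K p = rng K q"
  then obtain y g where q: "q = (y, g)" "y \<in> arrows G" "g \<in> arrows H" "src G y = rng H g"
    "src H h = rng G y"
    using p by (cases q) auto
  show "gmult K p q \<in> arrows K" "rng K (gmult K p q) = rng K p" "src K (gmult K p q) = src K q"
    using p q by simp_all
  assume "r \<in> arrows K" "src K q = rng K r"
  then obtain z k where r: "r = (z, k)" "z \<in> arrows G" "k \<in> arrows H" "src G z = rng H k"
    "src H g = rng G z"
    using q by (cases r) auto
  show "gmult K (gmult K p q) r = gmult K p (gmult K q r)"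
    using p q r by (simp add: mult_act' mult_res' act_mult' res_mult' G.assoc H.assoc)
qed

lemma iota_arrow: "x \<in> arrows G \<Longrightarrow> iota G x \<in> arrows K"
  by (simp add: iota_def)

text \<open>
  The unit spaces of \<open>G\<close> and \<open>H\<close> carry the same topology, so the source map of \<open>G\<close>, which is
  continuous as \<open>x \<mapsto> x\<^sup>-\<^sup>1 x\<close>, is also continuous into \<open>H\<close>.
\<close>

lemma continuous_src: "continuous_map (gtop G) (gtop H) (src G)"
proof -
  have "continuous_map (gtop G) (gtop G) (\<lambda>x. gmult G (ginv G x) x)"
    by (rule continuous_map_binop[OF G.continuous_mult G.continuous_inv])
      (simp_all add: composable_def flip: arrows_def)
  then have "continuous_map (gtop G) (gtop G) (src G)"
    by (rule continuous_map_eq) (simp flip: arrows_def)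
  then have "continuous_map (gtop G) (subtopology (gtop G) (units G)) (src G)"
    by (auto simp: continuous_map_in_subtopology simp flip: arrows_def)
  then show ?thesis
    unfolding same_unit_topology by (rule continuous_map_into_fulltopology)
qed

lemma pullback_iota:
  assumes "fell_bundle K C"
  shows "fell_bundle_pullback G K C (iota G)"
proof -
  interpret C: fell_bundle K C by fact
  show ?thesis
  proof
    show "continuous_map (gtop G) (gtop K) (iota G)"
    proof -
      have eq: "iota G = (\<lambda>x. (x, src G x))"
        by (auto simp: iota_def)
      show ?thesis
        unfolding gtop_K eq using continuous_src
        by (auto simp: continuous_map_in_subtopology simp flip: arrows_def
            intro!: continuous_map_pairedI)
    qed
  qed (simp_all add: iota_def unit_act' unit_res act_unit res_unit' unit_mult)
qed

end

section \<open>Unitary families\<close>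

locale unitary_bundle = matched_pair G H act res + C: fell_bundle "zappa_szep G H act res" C +
    unitary_family H C u
  for G H :: "'a groupoid" and act res :: "'a \<Rightarrow> 'a \<Rightarrow> 'a"
    and C :: "('a \<times> 'a, 'c) bundle_data" and u :: "'a \<Rightarrow> 'c"
begin

abbreviation cmult (infixl "\<odot>" 70) where "a \<odot> b \<equiv> bmult C a b"

text \<open>
  The range of \<open>(x, h)\<close> in the Zappa-Szep product is the unit \<open>r(x)\<close>, taken twice, and its source is
  the unit \<open>s(h)\<close>, taken twice.  Recording these units for the base point of an element makes
  composability the single equation \<open>R a = L b\<close>.
\<close>

definition L where "L c = rng G (fst (proj C c))"
definition R where "R c = src H (snd (proj C c))"

abbreviation E where "E \<equiv> total_space C"

lemma proj_C_cases:
  assumes "c \<in> E"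
  obtains x h where "proj C c = (x, h)" "x \<in> arrows G" "h \<in> arrows H" "src G x = rng H h"
    "L c = rng G x" "R c = src H h"
  using C.proj_arrows[OF assms] that by (cases "proj C c") (auto simp: L_def R_def)

lemma LR_units [simp]: "c \<in> E \<Longrightarrow> L c \<in> units G" "c \<in> E \<Longrightarrow> R c \<in> units G"
  by (auto elim!: proj_C_cases)

lemma comp_iff: "(a, b) \<in> bcomposable K C \<longleftrightarrow> a \<in> E \<and> b \<in> E \<and> R a = L b"
proof -
  have "rng K (proj C c) = (L c, L c)" "src K (proj C c) = (R c, R c)" if "c \<in> E" for c
    using that by (auto elim!: proj_C_cases)
  then show ?thesis
    by (auto simp: C.bcomposable_iff)
qed

lemma mult_E [simp]: "\<lbrakk>a \<in> E; b \<in> E; R a = L b\<rbrakk> \<Longrightarrow> a \<odot> b \<in> E"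
  and proj_mult: "\<lbrakk>a \<in> E; b \<in> E; R a = L b\<rbrakk> \<Longrightarrow> proj C (a \<odot> b) = gmult K (proj C a) (proj C b)"
  by (simp_all add: C.mult_closed C.proj_mult comp_iff)

lemma LR_mult [simp]:
  assumes "a \<in> E" "b \<in> E" "R a = L b"
  shows "L (a \<odot> b) = L a" "R (a \<odot> b) = R b"
proof -
  obtain x h where a: "proj C a = (x, h)" "x \<in> arrows G" "h \<in> arrows H" "src G x = rng H h"
    "L a = rng G x" "R a = src H h"
    using proj_C_cases[OF assms(1)] .
  obtain y g where b: "proj C b = (y, g)" "y \<in> arrows G" "g \<in> arrows H" "src G y = rng H g"
    "L b = rng G y" "R b = src H g"
    using proj_C_cases[OF assms(2)] .
  show "L (a \<odot> b) = L a" "R (a \<odot> b) = R b"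
    unfolding L_def R_def proj_mult[OF assms] using a b assms(3) by simp_all
qed

lemma star_E [simp]: "c \<in> E \<Longrightarrow> bstar C c \<in> E"
  by (rule C.star_closed)

lemma LR_star [simp]:
  assumes "c \<in> E"
  shows "L (bstar C c) = R c" "R (bstar C c) = L c"
  using assms by (auto simp: L_def R_def C.proj_star elim!: proj_C_cases)

lemma LR_scale [simp]:
  assumes "c \<in> E"
  shows "L (bscale C z c) = L c" "R (bscale C z c) = R c"
  using assms by (auto simp: L_def R_def C.fibre_scale)

lemma assoc: "\<lbrakk>a \<in> E; b \<in> E; c \<in> E; R a = L b; R b = L c\<rbrakk> \<Longrightarrow> a \<odot> b \<odot> c = a \<odot> (b \<odot> c)"
  by (rule C.bmult_assoc) (simp_all add: comp_iff)

lemma u_E [simp]: "h \<in> arrows H \<Longrightarrow> u h \<in> E"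
  and proj_u: "h \<in> arrows H \<Longrightarrow> proj C (u h) = (rng H h, h)"
  using u_fibre by (auto simp: fibre_def)

lemma LR_u [simp]: "h \<in> arrows H \<Longrightarrow> L (u h) = rng H h" "h \<in> arrows H \<Longrightarrow> R (u h) = src H h"
  by (simp_all add: L_def R_def proj_u)

lemma u_mult' [simp]: "\<lbrakk>h \<in> arrows H; k \<in> arrows H; src H h = rng H k\<rbrakk> \<Longrightarrow>
    u h \<odot> u k = u (gmult H h k)"
  by (simp add: u_mult composable_def)

lemma star_mult [simp]: "\<lbrakk>a \<in> E; b \<in> E; R a = L b\<rbrakk> \<Longrightarrow>
    bstar C (a \<odot> b) = bstar C b \<odot> bstar C a"
  by (simp add: C.star_mult comp_iff)

lemma star_u [simp]: "h \<in> arrows H \<Longrightarrow> bstar C (u h) = u (ginv H h)"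
  by (rule u_star)

text \<open>
  For \<open>d = c u\<^sub>v - c\<close>, the element \<open>c\<^sup>*c\<close> lies in the fibre over \<open>v\<close>, where \<open>u\<^sub>v\<close> is the identity;
  hence \<open>c\<^sup>*d = c\<^sup>*c u\<^sub>v - c\<^sup>*c = 0\<close>.  Therefore \<open>d\<^sup>*d = u\<^sub>v c\<^sup>*d - c\<^sup>*d = 0\<close>, and \<open>d = 0\<close> because
  \<open>\<parallel>d\<parallel>\<^sup>2 = \<parallel>d\<^sup>*d\<parallel>\<close>.
\<close>

lemma mult_u_unit [simp]:
  assumes c: "c \<in> E" and v: "R c = v"
  shows "c \<odot> u v = c"
proof -
  obtain x h where x: "proj C c = (x, h)" "x \<in> arrows G" "h \<in> arrows H" "src G x = rng H h"
    "L c = rng G x" "R c = src H h"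
    using proj_C_cases[OF c] .
  have vU: "v \<in> units G"
    using c v by auto
  note vs = unit_simps[OF this]
  let ?f = "bstar C c"
  have fc: "?f \<odot> c \<in> fibre C (v, v)"
    using K.mult_inv_left[of "(x, h)"] c v x
    by (simp add: fibre_def proj_mult C.proj_star del: zappa_szep_simps(3,4) K.mult_inv_left)
  have proj: "proj C (c \<odot> u v) = proj C c"
    using c v vs x K.mult_src_right[of "(x, h)"] by (simp add: proj_mult proj_u)
  interpret V: complex_banach_space "fibre C (proj C c)" "badd C" "bscale C" "bzero C (proj C c)" "bnorm C"
    by (rule C.banach_fibre) (rule C.proj_arrows[OF c])
  have vv: "(v, v) \<in> arrows K"
    using vs by simp
  interpret W: complex_banach_space "fibre C (v, v)" "badd C" "bscale C" "bzero C (v, v)" "bnorm C"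
    by (rule C.banach_fibre[OF vv])
  let ?d = "badd C (c \<odot> u v) (bscale C (-1) c)"
  have d: "?d \<in> E" "proj C ?d = proj C c"
    using c v vs proj by (simp_all add: C.fibre_add C.fibre_scale)
  have "?f \<odot> ?d = badd C (?f \<odot> (c \<odot> u v)) (?f \<odot> bscale C (-1) c)"
    by (rule C.mult_add_right)
      (use c v vs proj in \<open>simp_all add: comp_iff C.fibre_scale\<close>)
  also have "?f \<odot> (c \<odot> u v) = ?f \<odot> c"
    using c v vs u_unit_right[OF _ fc] vU by (simp add: same_units flip: assoc)
  also have "?f \<odot> bscale C (-1) c = bscale C (-1) (?f \<odot> c)"
    by (rule C.mult_scale_right) (use c in \<open>simp add: comp_iff\<close>)
  finally have fd: "?f \<odot> ?d = bzero C (v, v)"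
    using W.add_minus[OF fc] by simp
  have Ld: "L ?d = L c" "R ?d = v"
    using d v by (simp_all add: L_def R_def)
  have "bstar C ?d = badd C (u v \<odot> ?f) (bscale C (-1) ?f)"
    using C.star_add[of "c \<odot> u v" "bscale C (-1) c"] c v vs proj
    by (simp add: C.fibre_scale C.star_scale)
  then have "bstar C ?d \<odot> ?d = badd C (u v \<odot> ?f \<odot> ?d) (bscale C (-1) ?f \<odot> ?d)"
    using C.mult_add_left[of "u v \<odot> ?f" ?d "bscale C (-1) ?f"] c v vs d Ld proj
      C.proj_star[of "c \<odot> u v"]
    by (simp add: comp_iff C.fibre_scale C.proj_star)
  also have "bscale C (-1) ?f \<odot> ?d = bscale C (-1) (bzero C (v, v))"
    using C.mult_scale_left[of ?f ?d "-1"] c d Ld fd by (simp add: comp_iff)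
  also have "u v \<odot> ?f \<odot> ?d = u v \<odot> bzero C (v, v)"
    using c d v vs Ld fd by (simp add: assoc)
  also have "\<dots> = bzero C (v, v)"
    using u_unit_left W.zero_closed vU by (simp add: same_units)
  finally have "bstar C ?d \<odot> ?d = bzero C (v, v)"
    using W.add_minus[OF W.zero_closed] by simp
  then have "(bnorm C ?d)\<^sup>2 = 0"
    using C.norm_star_mult[OF d(1)] W.norm_eq_zero[OF W.zero_closed] by simp
  then have "?d = bzero C (proj C c)"
    using V.norm_eq_zero[of ?d] d by (simp add: fibre_def)
  then show ?thesis
    using V.diff_eq_zero_imp_eq[of "c \<odot> u v" c] c v vs proj by (simp add: fibre_def)
qed

lemma u_unit_mult [simp]:
  assumes "c \<in> E" "L c = v"
  shows "u v \<odot> c = c"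
proof -
  have "v \<in> units G"
    using assms by auto
  note v = unit_simps[OF this]
  have "bstar C c \<odot> u v = bstar C c"
    by (rule mult_u_unit) (use assms in simp_all)
  moreover have "bstar C (bstar C c \<odot> u v) = bstar C (u v) \<odot> bstar C (bstar C c)"
    by (rule star_mult) (use assms v in simp_all)
  ultimately show ?thesis
    using assms v by (simp add: C.star_star)
qed

lemma u_mult_left [simp]:
  assumes "h \<in> arrows H" "k \<in> arrows H" "src H h = rng H k" "c \<in> E" "src H k = L c"
  shows "u h \<odot> (u k \<odot> c) = u (gmult H h k) \<odot> c"
proof -
  have "u h \<odot> u k \<odot> c = u h \<odot> (u k \<odot> c)"
    by (rule assoc) (use assms in simp_all)
  then show ?thesis
    using assms(1-3) by simp
qed

text \<open>
  One has \<open>\<parallel>u\<^sub>h\<parallel>\<^sup>2 = \<parallel>u\<^sub>h\<^sup>*u\<^sub>h\<parallel> = \<parallel>u\<^sub>v\<parallel>\<close> with \<open>v = s(h)\<close>; for \<open>h = v\<close> this says that \<open>\<parallel>u\<^sub>v\<parallel>\<close> is \<open>0\<close> or \<open>1\<close>.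
  The value \<open>0\<close> occurs when the fibre over \<open>v\<close> is zero, so only an inequality holds.
\<close>

lemma norm_u:
  assumes h: "h \<in> arrows H"
  shows "bnorm C (u h) \<le> 1"
proof -
  have *: "(bnorm C (u h))\<^sup>2 = bnorm C (u (src H h))" if "h \<in> arrows H" for h
    using C.norm_star_mult[of "u h"] that by simp
  have "(bnorm C (u (src H h)))\<^sup>2 = bnorm C (u (src H h))"
    using *[of "src H h"] h by simp
  then have "bnorm C (u (src H h)) \<le> 1"
    by (auto simp: power2_eq_square)
  then have "(bnorm C (u h))\<^sup>2 \<le> 1\<^sup>2"
    using * h by simp
  then show ?thesis
    by (rule power2_le_imp_le) simp
qed

text \<open>
  Multiplying by \<open>u\<^sub>h\<close> does not increase the norm, and neither does multiplying back by
  \<open>u\<^sub>h\<^sup>* = u\<^bsub>h\<^sup>-\<^sup>1\<^esub>\<close>.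
\<close>

lemma norm_mult_u [simp]:
  assumes "c \<in> E" "h \<in> arrows H" "R c = rng H h"
  shows "bnorm C (c \<odot> u h) = bnorm C c"
proof -
  have le: "bnorm C (c \<odot> u h) \<le> bnorm C c" if "c \<in> E" "h \<in> arrows H" "R c = rng H h" for c h
    using C.norm_mult[of c "u h"] that mult_left_mono[OF norm_u C.norm_nonneg, of h c]
    by (simp add: comp_iff)
  have "c \<odot> u h \<odot> u (ginv H h) = c"
    using assms by (simp add: assoc)
  moreover have "bnorm C (c \<odot> u h \<odot> u (ginv H h)) \<le> bnorm C (c \<odot> u h)"
    by (rule le) (use assms in simp_all)
  ultimately show ?thesis
    using le[OF assms] by simp
qed

section \<open>The action by conjugation with the unitaries\<close>

sublocale P: fell_bundle_pullback G K C "iota G"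
  by (rule pullback_iota) (rule C.fell_bundle_axioms)

abbreviation \<beta> where "\<beta> \<equiv> unitary_action act res C u"

lemma beta_simp: "\<beta> h (x, c) = (act h x, u h \<odot> c \<odot> bstar C (u (res h x)))"
  by (simp add: unitary_action_def)

lemma total_PD:
  assumes "(x, c) \<in> total_space P.P"
  shows "x \<in> arrows G" "c \<in> E" "proj C c = (x, src G x)" "L c = rng G x" "R c = src G x"
  using assms by (auto simp: iota_def L_def R_def)

text \<open>
  With \<open>k = h|\<^sub>x\<close>, the base points multiply as
  \<open>(r(h), h) (x, s(x)) (s(k), k\<^sup>-\<^sup>1) = (h \<cdot> x, k) (s(k), k\<^sup>-\<^sup>1) = (h \<cdot> x, r(k))\<close>, and \<open>r(k) = s(h \<cdot> x)\<close>.
\<close>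

lemma beta_closed:
  assumes "h \<in> arrows H" "(x, c) \<in> total_space P.P" "src H h = rng G x"
  shows "\<beta> h (x, c) \<in> total_space P.P"
proof -
  note x = total_PD[OF assms(2)]
  have "proj C (u h \<odot> c) = (act h x, res h x)"
    using assms x by (simp add: proj_mult proj_u unit_mult res_unit' iota_def)
  then have "proj C (u h \<odot> c \<odot> bstar C (u (res h x))) = (act h x, rng H (res h x))"
    using assms x by (simp add: proj_mult proj_u act_unit res_unit' unit_mult iota_def)
  then show ?thesis
    using assms x by (simp add: beta_simp iota_def)
qed

lemma dom_iff: "(h, (x, c)) \<in> bundle_action_domain G H P.P \<longleftrightarrow>
    h \<in> arrows H \<and> (x, c) \<in> total_space P.P \<and> src H h = rng G x"
  by (simp add: bundle_action_domain_def)

lemma continuous_beta: "continuous_map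
    (subtopology (prod_topology (gtop H) (btop P.P)) (bundle_action_domain G H P.P)) (btop P.P)
    (\<lambda>(h, b). \<beta> h b)" (is "continuous_map ?X _ _")
proof -
  have h: "continuous_map ?X (gtop H) fst" and p: "continuous_map ?X (btop P.P) snd"
    by (intro continuous_map_from_subtopology continuous_map_fst continuous_map_snd)+
  have x: "continuous_map ?X (gtop G) (\<lambda>p. fst (snd p))"
    and c: "continuous_map ?X (btop C) (\<lambda>p. snd (snd p))"
    using continuous_map_compose[OF p P.continuous_fst_P]
      continuous_map_compose[OF p P.continuous_snd_P] by (simp_all add: o_def)
  have top: "fst p \<in> arrows H \<and> snd p \<in> total_space P.P \<and> src H (fst p) = rng G (fst (snd p))"
    if "p \<in> topspace ?X" for p
    using that by (auto simp: bundle_action_domain_def)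
  have dom: "(fst p, fst (snd p)) \<in> action_domain G H" if "p \<in> topspace ?X" for p
    using top[OF that] by (cases p; cases "snd p") (auto simp: action_domain_def)
  note act = continuous_map_binop[OF continuous_act h x dom]
  note res = continuous_map_binop[OF continuous_res h x dom]
  have uh: "continuous_map ?X (btop C) (\<lambda>p. u (fst p))"
    using continuous_map_compose[OF h continuous_u] by (simp add: o_def)
  have us: "continuous_map ?X (btop C) (\<lambda>p. bstar C (u (res (fst p) (fst (snd p)))))"
    using continuous_map_compose[OF continuous_map_compose[OF res continuous_u]
      C.continuous_bstar] by (simp add: o_def)
  have "continuous_map ?X (btop P.P) (\<lambda>p. (act (fst p) (fst (snd p)),
      u (fst p) \<odot> snd (snd p) \<odot> bstar C (u (res (fst p) (fst (snd p))))))"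
  proof (intro P.continuous_map_into_P C.continuous_map_bmult act uh c us)
    fix p assume "p \<in> topspace ?X"
    then obtain h x c where p: "p = (h, (x, c))" "h \<in> arrows H" "(x, c) \<in> total_space P.P"
      "src H h = rng G x"
      using top by (cases p; cases "snd p") auto
    note x = total_PD[OF p(3)]
    show "(u (fst p), snd (snd p)) \<in> bcomposable K C"
      "(u (fst p) \<odot> snd (snd p), bstar C (u (res (fst p) (fst (snd p))))) \<in> bcomposable K C"
      using p x by (simp_all add: comp_iff)
    show "iota G (act (fst p) (fst (snd p))) =
        proj C (u (fst p) \<odot> snd (snd p) \<odot> bstar C (u (res (fst p) (fst (snd p)))))"
      using beta_closed[OF p(2,3,4)] p(1) by (simp add: beta_simp del: star_u)
  qed
  then show ?thesis
    by (rule continuous_map_eq) (auto simp: beta_simp)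
qed

text \<open>
  Once units cancel, the identities for \<open>\<beta>\<close> are computations with \<open>u\<close>.  Compatibility with products
  inserts \<open>u\<^sub>k\<^sup>* u\<^sub>k\<close> for \<open>k = h|\<^sub>x\<close> between the two factors; compatibility with the involution uses
  \<open>(h|\<^sub>x)|\<^sub>y = h\<close> for \<open>y = x\<^sup>-\<^sup>1\<close>.
\<close>

lemma compatible_action: "compatible_action G H act res P.P \<beta>"
proof (intro compatible_action.intro compatible_action_axioms.intro matched_pair_axioms
    P.fell_bundle continuous_beta)
  fix h p
  assume "(h, p) \<in> bundle_action_domain G H P.P"
  then obtain x c where p: "p = (x, c)" "h \<in> arrows H" "(x, c) \<in> total_space P.P"
    "src H h = rng G x"
    by (cases p) (simp add: dom_iff)
  note x = total_PD[OF p(3)]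
  note [simp] = beta_simp p(1,2,4) x
  show "proj P.P (\<beta> h p) = act h (proj P.P p)"
    by simp
  show "bstar P.P (\<beta> h p) = \<beta> (res h (proj P.P p)) (bstar P.P p)"
    by (simp add: inv_act assoc)
  show "\<beta> h (bscale P.P z p) = bscale P.P z (\<beta> h p)" for z
    using C.mult_scale_right[of "u h" c z] C.mult_scale_left[of "u h \<odot> c" "u (ginv H (res h x))" z]
    by (simp add: comp_iff)
  show "\<beta> (gmult H g h) p = \<beta> g (\<beta> h p)" if "(g, h) \<in> composable H" for g
    using that by (simp add: composable_def mult_act' mult_res' assoc H.inv_mult)
  show "\<beta> h p = p" if "h \<in> units H"
    using that unit_simps[of h] by (simp add: same_units unit_act' unit_res)
  show "\<beta> h (badd P.P p q) = badd P.P (\<beta> h p) (\<beta> h q)"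
    if hq: "(h, q) \<in> bundle_action_domain G H P.P" "proj P.P p = proj P.P q" for q
  proof -
    obtain d where q: "q = (x, d)" "(x, d) \<in> total_space P.P"
      using hq by (cases q) (auto simp: dom_iff)
    note y = total_PD[OF q(2)]
    show ?thesis
      using C.mult_add_right[of "u h" c d] y q(1)
        C.mult_add_left[of "u h \<odot> c" "u (ginv H (res h x))" "u h \<odot> d"]
      by (simp add: comp_iff proj_mult)
  qed
  show "\<beta> h (bmult P.P p q) = bmult P.P (\<beta> h p) (\<beta> (res h (proj P.P p)) q)"
    if pq: "(p, q) \<in> bcomposable G P.P" for q
  proof -
    obtain y d where q: "q = (y, d)" "(y, d) \<in> total_space P.P" "src G x = rng G y"
      using pq by (cases q) (simp add: P.comp_P)
    note y = total_PD[OF q(2)]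
    show ?thesis
      using y q(1,3) by (simp add: act_mult' res_mult' assoc)
  qed
qed

end

context unitary_bundle
begin

section \<open>The isomorphism\<close>

abbreviation D where "D \<equiv> product_bundle G H res P.P \<beta>"

lemma product_simps [simp]:
  "proj D (p, h) = (fst p, h)"
  "badd D (p, g) (q, h) = (badd P.P p q, g)"
  "bscale D z (p, h) = (bscale P.P z p, h)"
  "bzero D (x, h) = (bzero P.P x, h)"
  "bnorm D (p, h) = bnorm P.P p"
  "bmult D (p, g) (q, h) = (bmult P.P p (\<beta> g q), gmult H (res g (fst q)) h)"
  "bstar D (p, h) = (\<beta> (ginv H h) (bstar P.P p), res (ginv H h) (ginv G (fst p)))"
  by (simp_all add: product_bundle_def)

lemma btop_D: "btop D = subtopology (prod_topology (btop P.P) (gtop H))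
    {(b, h). src G (fst b) = rng H h}"
  by (simp add: product_bundle_def)

lemma total_D: "((x, c), h) \<in> total_space D \<longleftrightarrow>
    (x, c) \<in> total_space P.P \<and> h \<in> arrows H \<and> src G x = rng H h"
  by (auto simp: total_space_def arrows_def btop_D)

lemma total_D_cases:
  assumes "d \<in> total_space D"
  obtains x c h where "d = ((x, c), h)" "(x, c) \<in> total_space P.P" "h \<in> arrows H"
    "src G x = rng H h" "x \<in> arrows G" "c \<in> E" "proj C c = (x, src G x)" "L c = rng G x"
    "R c = rng H h"
proof -
  obtain x c h where d: "d = ((x, c), h)"
    by (cases d) (metis surj_pair)
  then have "(x, c) \<in> total_space P.P" "h \<in> arrows H" "src G x = rng H h"
    using assms by (simp_all add: total_D)
  with total_PD[OF this(1)] d that show thesis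
    by metis
qed

abbreviation \<Theta> where "\<Theta> \<equiv> Theta C u"

lemma Theta_simp [simp]: "\<Theta> ((x, c), h) = c \<odot> u h"
  by (simp add: Theta_def)

text \<open>
  The inverse of \<open>\<Theta>\<close>, which multiplies an element over \<open>(x, h)\<close> by \<open>u\<^sub>h\<^sup>* = u\<^bsub>h\<^sup>-\<^sup>1\<^esub>\<close>.
\<close>

definition \<Theta>' where
  "\<Theta>' c = ((fst (proj C c), c \<odot> u (ginv H (snd (proj C c)))), snd (proj C c))"

lemma proj_Theta:
  assumes "d \<in> total_space D"
  shows "proj C (\<Theta> d) = proj D d"
  using assms
  by (elim total_D_cases) (simp add: proj_mult proj_u act_unit unit_res unit_mult unit_act' iota_def)

lemma Theta_E:
  assumes "d \<in> total_space D"
  shows "\<Theta> d \<in> E"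
  using assms by (elim total_D_cases) simp

lemma Theta'_total:
  assumes "c \<in> E"
  shows "\<Theta>' c \<in> total_space D"
proof -
  obtain x h where x: "proj C c = (x, h)" "x \<in> arrows G" "h \<in> arrows H" "src G x = rng H h"
    "L c = rng G x" "R c = src H h"
    using proj_C_cases[OF assms] .
  then have "proj C (c \<odot> u (ginv H h)) = iota G x"
    using assms by (simp add: proj_mult proj_u act_unit unit_mult res_unit' iota_def)
  then show ?thesis
    using assms x by (simp add: \<Theta>'_def total_D)
qed

lemma Theta_Theta':
  assumes "c \<in> E"
  shows "\<Theta> (\<Theta>' c) = c"
proof -
  obtain x h where x: "proj C c = (x, h)" "x \<in> arrows G" "h \<in> arrows H" "src G x = rng H h"
    "L c = rng G x" "R c = src H h"
    using proj_C_cases[OF assms] .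
  then show ?thesis
    using assms by (simp add: \<Theta>'_def assoc)
qed

lemma Theta'_Theta:
  assumes "d \<in> total_space D"
  shows "\<Theta>' (\<Theta> d) = d"
proof -
  have "proj C (\<Theta> d) = proj D d"
    using assms by (rule proj_Theta)
  then show ?thesis
    using assms by (elim total_D_cases) (simp add: \<Theta>'_def assoc)
qed

lemma continuous_Theta: "continuous_map (btop D) (btop C) \<Theta>"
proof -
  have p: "continuous_map (btop D) (btop P.P) fst" and h: "continuous_map (btop D) (gtop H) snd"
    unfolding btop_D
    by (intro continuous_map_from_subtopology continuous_map_fst continuous_map_snd)+
  have "continuous_map (btop D) (btop C) (\<lambda>d. snd (fst d) \<odot> u (snd d))"
  proof (rule C.continuous_map_bmult)
    show "continuous_map (btop D) (btop C) (\<lambda>d. snd (fst d))"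
      using continuous_map_compose[OF p P.continuous_snd_P] by (simp add: o_def)
    show "continuous_map (btop D) (btop C) (\<lambda>d. u (snd d))"
      using continuous_map_compose[OF h continuous_u] by (simp add: o_def)
    show "(snd (fst d), u (snd d)) \<in> bcomposable K C" if "d \<in> topspace (btop D)" for d
      using that[folded total_space_def] by (elim total_D_cases) (simp add: comp_iff)
  qed
  then show ?thesis
    by (rule continuous_map_eq) (auto simp: Theta_def)
qed

lemma continuous_Theta': "continuous_map (btop C) (btop D) \<Theta>'"
proof -
  have pr: "continuous_map (btop C) (prod_topology (gtop G) (gtop H)) (proj C)"
    using C.continuous_proj unfolding gtop_K by (rule continuous_map_into_fulltopology)
  have x: "continuous_map (btop C) (gtop G) (\<lambda>c. fst (proj C c))"
    and h: "continuous_map (btop C) (gtop H) (\<lambda>c. snd (proj C c))"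
    using continuous_map_compose[OF pr continuous_map_fst]
      continuous_map_compose[OF pr continuous_map_snd] by (simp_all add: o_def)
  have "continuous_map (btop C) (btop C) (\<lambda>c. c \<odot> u (ginv H (snd (proj C c))))"
  proof (rule C.continuous_map_bmult)
    show "continuous_map (btop C) (btop C) (\<lambda>c. u (ginv H (snd (proj C c))))"
      using continuous_map_compose[OF continuous_map_compose[OF h H.continuous_inv] continuous_u]
      by (simp add: o_def)
    fix c assume "c \<in> topspace (btop C)"
    then have c: "c \<in> E"
      by (simp add: total_space_def)
    then show "(c, u (ginv H (snd (proj C c)))) \<in> bcomposable K C"
      by (rule proj_C_cases) (use c in \<open>simp add: comp_iff\<close>)
  qed simp
  moreover have "iota G (fst (proj C c)) = proj C (c \<odot> u (ginv H (snd (proj C c))))"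
    "src G (fst (proj C c)) = rng H (snd (proj C c))" if "c \<in> topspace (btop C)" for c
    using Theta'_total[of c] that[folded total_space_def] by (auto simp: \<Theta>'_def total_D)
  ultimately show ?thesis
    unfolding btop_D \<Theta>'_def[abs_def] using x h
    by (auto simp: continuous_map_in_subtopology intro!: continuous_map_pairedI
        P.continuous_map_into_P)
qed

lemma bstar_D_total:
  assumes "d \<in> total_space D"
  shows "bstar D d \<in> total_space D"
  using assms
proof (rule total_D_cases)
  fix x c h
  assume d: "d = ((x, c), h)" "(x, c) \<in> total_space P.P" "h \<in> arrows H"
    "src G x = rng H h" "x \<in> arrows G" "c \<in> E" "proj C c = (x, src G x)" "L c = rng G x"
    "R c = rng H h"
  have "bstar P.P (x, c) \<in> total_space P.P"
    by (rule fell_bundle.star_closed[OF P.fell_bundle d(2)])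
  then have "\<beta> (ginv H h) (ginv G x, bstar C c) \<in> total_space P.P"
    using d by (intro beta_closed) simp_all
  then show ?thesis
    using d by (simp add: beta_simp total_D del: P.total_P)
qed

lemma bmult_D_total:
  assumes "(d, e) \<in> bcomposable K D"
  shows "bmult D d e \<in> total_space D"
proof -
  have de: "d \<in> total_space D" "e \<in> total_space D" "src K (proj D d) = rng K (proj D e)"
    using assms by (simp_all add: bcomposable_def composable_def)
  obtain x c h where d: "d = ((x, c), h)" "(x, c) \<in> total_space P.P" "h \<in> arrows H"
    "src G x = rng H h"
    using total_D_cases[OF de(1)] .
  obtain y b g where e: "e = ((y, b), g)" "(y, b) \<in> total_space P.P" "g \<in> arrows H"
    "src G y = rng H g"
    using total_D_cases[OF de(2)] .
  have hy: "src H h = rng G y" and xy: "x \<in> arrows G" "y \<in> arrows G"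
    using de(3) d(1,2) e(1,2) by simp_all
  have "bmult P.P (x, c) (\<beta> h (y, b)) \<in> total_space P.P"
    using d e hy xy beta_closed[OF d(3) e(2) hy]
    by (intro fell_bundle.mult_closed[OF P.fell_bundle])
      (simp add: P.P.bcomposable_iff beta_simp del: P.total_P)
  then show ?thesis
    using d e hy xy by (simp add: total_D beta_simp del: P.total_P)
qed

sublocale Theta: fell_bundle_transport K C D \<Theta> \<Theta>'
proof
  show "homeomorphic_maps (btop D) (btop C) \<Theta> \<Theta>'"
    unfolding homeomorphic_maps_def
    using continuous_Theta continuous_Theta' Theta_Theta' Theta'_Theta
    by (simp add: total_space_def)
next
  fix p assume "p \<in> arrows K"
  then obtain x h where p: "p = (x, h)" "x \<in> arrows G" "h \<in> arrows H" "src G x = rng H h"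
    by (cases p) auto
  have z: "bzero C (iota G x) \<in> E" "proj C (bzero C (iota G x)) = (x, src G x)"
    using C.fibre_zero[OF iota_arrow[OF p(2)]] by (simp_all add: iota_def)
  then show D: "bzero D p \<in> total_space D"
    using p by (simp add: total_D iota_def)
  have z': "R (bzero C (iota G x)) = rng H h"
    using z p by (simp add: R_def)
  \<comment> \<open>\<open>\<Theta>\<close> maps zero to zero because zero is \<open>0\<close> times itself and \<open>\<Theta>\<close> commutes with scaling.\<close>
  have "\<Theta> (bzero D p) = bscale C 0 (bzero C (iota G x)) \<odot> u h"
    using p C.scale_0[OF z(1)] z(2) by (simp add: iota_def)
  also have "\<dots> = bscale C 0 (\<Theta> (bzero D p))"
    using C.mult_scale_left[of "bzero C (iota G x)" "u h" 0] p z z' by (simp add: comp_iff)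
  also have "\<dots> = bzero C p"
    using C.scale_0[OF Theta_E[OF D]] proj_Theta[OF D] p by simp
  finally show "\<Theta> (bzero D p) = bzero C p" .
next
  fix d assume d: "d \<in> total_space D"
  then obtain x c h where d': "d = ((x, c), h)" "(x, c) \<in> total_space P.P" "h \<in> arrows H"
    "src G x = rng H h" and x: "x \<in> arrows G" "c \<in> E" "proj C c = (x, src G x)" "L c = rng G x"
    "R c = rng H h"
    by (rule total_D_cases)
  show "proj C (\<Theta> d) = proj D d"
    by (rule proj_Theta[OF d])
  show "bnorm C (\<Theta> d) = bnorm D d"
    using d' x by simp
  show "bscale D z d \<in> total_space D" "\<Theta> (bscale D z d) = bscale C z (\<Theta> d)" for z
    using d' x C.mult_scale_left[of c "u h" z] by (simp_all add: total_D C.fibre_scale comp_iff)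
  show "bstar D d \<in> total_space D"
    by (rule bstar_D_total[OF d])
  show "\<Theta> (bstar D d) = bstar C (\<Theta> d)"
    using d' x by (simp add: beta_simp assoc)
  fix e assume e: "e \<in> total_space D"
  then obtain y b g where e': "e = ((y, b), g)" "(y, b) \<in> total_space P.P" "g \<in> arrows H"
    "src G y = rng H g" and y: "y \<in> arrows G" "b \<in> E" "proj C b = (y, src G y)" "L b = rng G y"
    "R b = rng H g"
    by (rule total_D_cases)
  show "badd D d e \<in> total_space D" "\<Theta> (badd D d e) = badd C (\<Theta> d) (\<Theta> e)"
    if "proj D d = proj D e"
    using that d' x e' y C.mult_add_left[of c "u h" b]
    by (simp_all add: total_D C.fibre_add comp_iff)
next
  fix d e assume de: "(d, e) \<in> bcomposable K D"
  show "bmult D d e \<in> total_space D"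
    by (rule bmult_D_total[OF de])
  have "d \<in> total_space D" "e \<in> total_space D" and comp: "src K (proj D d) = rng K (proj D e)"
    using de by (simp_all add: bcomposable_def composable_def)
  obtain x c h where d: "d = ((x, c), h)" "x \<in> arrows G" "c \<in> E" "L c = rng G x"
    "R c = rng H h" "h \<in> arrows H"
    using total_D_cases[OF \<open>d \<in> total_space D\<close>] .
  obtain y b g where e: "e = ((y, b), g)" "y \<in> arrows G" "b \<in> E" "L b = rng G y"
    "R b = rng H g" "g \<in> arrows H" "src G y = rng H g"
    using total_D_cases[OF \<open>e \<in> total_space D\<close>] .
  show "\<Theta> (bmult D d e) = \<Theta> d \<odot> \<Theta> e"
    using d e comp by (simp add: beta_simp assoc flip: H.assoc)
qed

lemma isometric_isomorphism: "fell_bundle_isometric_isomorphism K D C \<Theta>"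
  by (intro fell_bundle_isometric_isomorphism.intro fell_bundle_isometric_isomorphism_axioms.intro
      Theta.fell_bundle C.fell_bundle_axioms Theta.continuous_T Theta.bij_T Theta.T_proj
      Theta.T_add Theta.T_scale Theta.T_mult Theta.T_star Theta.T_norm)

end

theorem theorem3p15:
  fixes G H :: "'a groupoid"
    and act res :: "'a \<Rightarrow> 'a \<Rightarrow> 'a"
    and C :: "('a \<times> 'a, 'c) bundle_data"
    and u :: "'a \<Rightarrow> 'c"
  assumes "matched_pair G H act res"
    and "fell_bundle (zappa_szep G H act res) C"
    and "unitary_family H C u"
  shows "compatible_action G H act res (pullback G (iota G) C) (unitary_action act res C u)
    \<and> fell_bundle_isometric_isomorphism (zappa_szep G H act res)
        (product_bundle G H res (pullback G (iota G) C) (unitary_action act res C u)) C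
        (Theta C u)"
proof -
  interpret unitary_bundle G H act res C u
    using assms by (rule unitary_bundle.intro)
  show ?thesis
    using compatible_action isometric_isomorphism ..
qed

end
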